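(* Let $\mathcal B(n,l)$ be the reflection algebra with generating matrix $B(u)$ and Sklyanin determinant $\operatorname{sdet}B(u)$. For $k=1,\dots,n$ define $$\Pi_k:=1-\frac{1}{2u-k-n+2}\sum_{i=k+1}^{n}P_{ki},$$ and put $$\langle\langle B_1,\dots,B_n\rangle\rangle:=B_1(u)\,\Pi_1\,B_2(u-1)\,\Pi_2\cdots B_{n-1}(u-n+2)\,\Pi_{n-1}\,B_n(u-n+1).$$ Then $$A_n\langle\langle B_1,\dots,B_n\rangle\rangle=\operatorname{sdet}B(u)\,A_n .$$
   Context: Reflection algebra. Let $n=m+l$ with $m,l$ nonnegative integers, and $\varepsilon_i=1$ for $1\le i\le m$, $\varepsilon_i=-1$ for $m<i\le n$. Let $P:v\otimes w\mapsto w\otimes v$ on $\mathbb C^n\otimes\mathbb C^n$ and $R(u)=1-P/u$. The reflection algebra $\mathcal B(n,l)$ is the unital associative algebra over $\mathbb C$ with generators $b_{ij}^{(r)}$ ($i,j=1,\dots,n$, $r=0,1,2,\dots$), $b_{ij}^{(0)}=\delta_{ij}\varepsilon_i$, collected into series $b_i^j(u)=\sum_{r\ge0}b_{ij}^{(r)}u^{-r}$ and the matrix $B(u)=\sum_{i,j}E_{ij}\otimes b_i^j(u)\in\operatorname{End}\mathbb C^n\otimes\mathcal B(n,l)[[u^{-1}]]$, subject to the reflection equation $R(u-v)B_1(u)R(u+v)B_2(v)=B_2(v)R(u+v)B_1(u)R(u-v)$ and the unitary condition $B(u)B(-u)=1$. For a matrix $X=(x_{ij})$ over an associative algebra $A$,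 $X_s=\sum_{i,j}1\otimes\cdots\otimes E_{ij}\otimes\cdots\otimes1\otimes x_{ij}\in\operatorname{End}(\mathbb C^n)^{\otimes k}\otimes A$ with $E_{ij}$ in the $s$-th position; $P_{ij}$ and $R_{ij}(u)$ denote $P$ and $R(u)$ acting on the $i$-th and $j$-th copies of $\mathbb C^n$. Shifted series and rational functions of $u$ are expanded as power series in $u^{-1}$. Sklyanin determinant. Abbreviate $R_{ij}:=R_{ij}(2u-i-j+2)$, and put $\langle B_1,\dots,B_n\rangle=B_1(u)(R_{12}\cdots R_{1n})B_2(u-1)(R_{23}\cdots R_{2n})\cdots B_n(u-n+1)$. Let $A_n(v_1\otimes\cdots\otimes v_n)=\sum_{\sigma\in S_n}(-1)^\sigma v_{\sigma(1)}\otimes\cdots\otimes v_{\sigma(n)}$ (no normalization). It is known that $A_n\langle B_1,\dots,B_n\rangle$ equals $A_n$ times a series in $u^{-1}$ with coefficients in $\mathcal B(n,l)$; this series is $\operatorname{sdet}B(u)$, i.e. $A_n\langle B_1,\dots,B_n\rangle=\operatorname{sdet}B(u)\,A_n$. *)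

theory Defs
  imports
    "HOL-Computational_Algebra.Computational_Algebra"
    "HOL-Combinatorics.Permutations"
    "HOL-Library.FuncSet"
    "HOL-Library.Poly_Mapping"
    "HOL-Library.Type_Length"
begin

section \<open>Matrices acting on tensor powers\<close>

text \<open>
  The multi-indices \<open>I = (I 1, \<dots>, I k)\<close> label the basis
  \<open>e\<^bsub>I 1\<^esub> \<otimes> \<dots> \<otimes> e\<^bsub>I k\<^esub>\<close> of the \<open>k\<close>-th tensor power of
  \<open>\<complex>\<^sup>n\<close>. An element of \<open>End(\<complex>\<^sup>n)\<^sup>\<otimes>\<^sup>k \<otimes> A\<close> is given by its
  entries: \<open>X I J\<close> is the coefficient in \<open>A\<close> of
  \<open>E\<^bsub>I 1, J 1\<^esub> \<otimes> \<dots> \<otimes> E\<^bsub>I k, J k\<^esub>\<close>. All operators below vanish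
  outside the multi-indices, so equality of operators is equality of functions.
\<close>

definition tidx :: "nat \<Rightarrow> nat \<Rightarrow> (nat \<Rightarrow> nat) set" where
  "tidx n k = {1..k} \<rightarrow>\<^sub>E {1..n}"

type_synonym 'a tmat = "(nat \<Rightarrow> nat) \<Rightarrow> (nat \<Rightarrow> nat) \<Rightarrow> 'a"

definition tone :: "nat \<Rightarrow> nat \<Rightarrow> 'a::zero_neq_one tmat" where
  "tone n k = (\<lambda>I J. if J \<in> tidx n k \<and> I = J then 1 else 0)"

definition tmult :: "nat \<Rightarrow> nat \<Rightarrow> 'a::semiring_0 tmat \<Rightarrow> 'a tmat \<Rightarrow> 'a tmat" where
  "tmult n k X Y = (\<lambda>I J. \<Sum>K\<in>tidx n k. X I K * Y K J)"

definition tprod :: "nat \<Rightarrow> nat \<Rightarrow> 'a::ring_1 tmat list \<Rightarrow> 'a tmat" where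
  "tprod n k Xs = foldr (tmult n k) Xs (tone n k)"

definition tscale :: "'a::times \<Rightarrow> 'a tmat \<Rightarrow> 'a tmat" where
  "tscale c X = (\<lambda>I J. c * X I J)"

text \<open>The matrix \<open>X\<^sub>s\<close>: a matrix over \<open>A\<close> acting in the \<open>s\<close>-th tensor factor.\<close>

definition temb :: "nat \<Rightarrow> nat \<Rightarrow> nat \<Rightarrow> (nat \<Rightarrow> nat \<Rightarrow> 'a::zero) \<Rightarrow> 'a tmat" where
  "temb n k s X = (\<lambda>I J.
     if I \<in> tidx n k \<and> J \<in> tidx n k \<and> (\<forall>t\<in>{1..k} - {s}. I t = J t) then X (I s) (J s) else 0)"

text \<open>
  The operator \<open>v\<^sub>1 \<otimes> \<dots> \<otimes> v\<^sub>k \<mapsto> v\<^bsub>\<sigma>(1)\<^esub> \<otimes> \<dots> \<otimes> v\<^bsub>\<sigma>(k)\<^esub>\<close>, for \<open>\<sigma>\<close> permuting \<open>{1..k}\<close>.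
\<close>

definition tperm :: "nat \<Rightarrow> nat \<Rightarrow> (nat \<Rightarrow> nat) \<Rightarrow> 'a::zero_neq_one tmat" where
  "tperm n k \<sigma> = (\<lambda>I J. if J \<in> tidx n k \<and> I = J \<circ> \<sigma> then 1 else 0)"

definition tP :: "nat \<Rightarrow> nat \<Rightarrow> nat \<Rightarrow> nat \<Rightarrow> 'a::zero_neq_one tmat" where
  "tP n k i j = tperm n k (Transposition.transpose i j)"

text \<open>\<open>R\<^sub>i\<^sub>j(w) = 1 - P\<^sub>i\<^sub>j/w\<close>, where the argument \<open>winv\<close> is (the expansion of) \<open>1/w\<close>.\<close>

definition tR :: "nat \<Rightarrow> nat \<Rightarrow> nat \<Rightarrow> nat \<Rightarrow> 'a::ring_1 \<Rightarrow> 'a tmat" where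
  "tR n k i j winv = (\<lambda>I J. tone n k I J - winv * tP n k i j I J)"

definition antisymmetrizer :: "nat \<Rightarrow> 'a::ring_1 tmat" where
  "antisymmetrizer n = (\<lambda>I J. \<Sum>\<sigma> | \<sigma> permutes {1..n}. of_int (sign \<sigma>) * tperm n n \<sigma> I J)"


section \<open>Series in the inverse variable\<close>

text \<open>
  A series in \<open>u\<^sup>-\<^sup>1\<close> is a formal power series whose variable stands for \<open>u\<^sup>-\<^sup>1\<close>.
  For central \<open>c\<close>, \<open>1/(u - c)\<close> expands as the sum of \<open>c\<^sup>r\<^sup>-\<^sup>1 u\<^sup>-\<^sup>r\<close> over \<open>r \<ge> 1\<close>. As
  \<open>f(u - c)\<close> results from replacing \<open>u\<^sup>-\<^sup>1\<close> by \<open>1/(u - c)\<close> in \<open>f(u)\<close>, it is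
  \<open>f oo inv_u_minus c\<close>.
\<close>

definition inv_u_minus :: "'a::ring_1 \<Rightarrow> 'a fps" where
  "inv_u_minus c = Abs_fps (\<lambda>r. if r = 0 then 0 else c ^ (r - 1))"

lemma inv_u_minus_eq: "(1 - fps_const c * fps_X) * inv_u_minus c = fps_X"
proof (rule fps_ext)
  fix r
  have "(1 - fps_const c * fps_X) * inv_u_minus c
      = inv_u_minus c - fps_const c * (fps_X * inv_u_minus c)"
    by (simp only: left_diff_distrib mult_1 mult.assoc)
  then have "fps_nth ((1 - fps_const c * fps_X) * inv_u_minus c) r =
      fps_nth (inv_u_minus c) r - c * (if r = 0 then 0 else fps_nth (inv_u_minus c) (r - 1))"
    by simp
  also have "\<dots> = fps_nth fps_X r"
    by (cases r; cases "r - 1") (auto simp: inv_u_minus_def)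
  finally show "fps_nth ((1 - fps_const c * fps_X) * inv_u_minus c) r = fps_nth fps_X r" .
qed


section \<open>The free associative algebra and two-sided ideals\<close>

datatype 'g fmonoid = Word "'g list"

primrec letters :: "'g fmonoid \<Rightarrow> 'g list" where
  "letters (Word w) = w"

lemma Word_letters [simp]: "Word (letters w) = w"
  by (cases w) simp

instantiation fmonoid :: (type) monoid_add
begin

definition "0 = Word []"

definition "v + w = Word (letters v @ letters w)"

instance
  by standard (simp_all add: zero_fmonoid_def plus_fmonoid_def)

end

type_synonym 'g free_alg = "'g fmonoid \<Rightarrow>\<^sub>0 complex"

inductive_set ideal_gen :: "'a::ring_1 set \<Rightarrow> 'a set" for S where
  zero: "0 \<in> ideal_gen S"
| step: "x \<in> ideal_gen S \<Longrightarrow> s \<in> S \<Longrightarrow> a * s * b + x \<in> ideal_gen S"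

lemma ideal_gen_add: "x \<in> ideal_gen S \<Longrightarrow> y \<in> ideal_gen S \<Longrightarrow> x + y \<in> ideal_gen S"
  by (induction rule: ideal_gen.induct) (auto simp: add.assoc intro: ideal_gen.step)

lemma ideal_gen_mult_left: "x \<in> ideal_gen S \<Longrightarrow> c * x \<in> ideal_gen S"
proof (induction rule: ideal_gen.induct)
  case (step x s a b)
  then show ?case
    using ideal_gen.step[of "c * x" S s "c * a" b] by (simp add: algebra_simps)
qed (simp add: ideal_gen.zero)

lemma ideal_gen_mult_right: "x \<in> ideal_gen S \<Longrightarrow> x * c \<in> ideal_gen S"
proof (induction rule: ideal_gen.induct)
  case (step x s a b)
  then show ?case
    using ideal_gen.step[of "x * c" S s a "b * c"] by (simp add: algebra_simps)
qed (simp add: ideal_gen.zero)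

lemma ideal_gen_uminus: "x \<in> ideal_gen S \<Longrightarrow> - x \<in> ideal_gen S"
  using ideal_gen_mult_left[of x S "-1"] by simp

lemma ideal_gen_minus: "x \<in> ideal_gen S \<Longrightarrow> y \<in> ideal_gen S \<Longrightarrow> x - y \<in> ideal_gen S"
  using ideal_gen_add[OF _ ideal_gen_uminus] by fastforce


section \<open>The reflection algebra\<close>

text \<open>The symbol \<open>(i, j, r)\<close> is the generator \<open>b\<^sub>i\<^sub>j\<close> of degree \<open>r\<close>.\<close>

type_synonym bsym = "nat \<times> nat \<times> nat"

definition free_b :: "nat \<Rightarrow> nat \<Rightarrow> nat \<Rightarrow> bsym free_alg" where
  "free_b i j r = Poly_Mapping.single (Word [(i, j, r)]) 1"

definition free_scalar :: "complex \<Rightarrow> bsym free_alg" where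
  "free_scalar c = Poly_Mapping.single 0 c"

definition refl_sign :: "nat \<Rightarrow> nat \<Rightarrow> complex" where
  "refl_sign m i = (if i \<le> m then 1 else - 1)"

text \<open>
  The two sides of the reflection equation. The outer series are series in \<open>u\<^sup>-\<^sup>1\<close>, their
  coefficients are Laurent series in \<open>v\<^sup>-\<^sup>1\<close> (so \<^term>\<open>fls_X_inv\<close> is \<open>v\<close>), and
  \<open>1/(u - v)\<close>, \<open>1/(u + v)\<close> are expanded in powers of \<open>u\<^sup>-\<^sup>1\<close>. Since \<open>u\<^sup>2 - v\<^sup>2\<close> is
  invertible there, the equation is equivalent to the one with denominators cleared.
\<close>

definition B_of_u :: "(nat \<Rightarrow> nat \<Rightarrow> nat \<Rightarrow> 'a) \<Rightarrow> nat \<Rightarrow> nat \<Rightarrow> 'a::ring_1 fls fps" where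
  "B_of_u b i j = Abs_fps (\<lambda>r. fls_const (b i j r))"

definition B_of_v :: "(nat \<Rightarrow> nat \<Rightarrow> nat \<Rightarrow> 'a) \<Rightarrow> nat \<Rightarrow> nat \<Rightarrow> 'a::ring_1 fls fps" where
  "B_of_v b i j = fps_const (fps_to_fls (Abs_fps (b i j)))"

definition refl_eq_lhs :: "nat \<Rightarrow> (nat \<Rightarrow> nat \<Rightarrow> nat \<Rightarrow> 'a::ring_1) \<Rightarrow> 'a fls fps tmat" where
  "refl_eq_lhs n b = tprod n 2
     [tR n 2 1 2 (inv_u_minus fls_X_inv), temb n 2 1 (B_of_u b),
      tR n 2 1 2 (inv_u_minus (- fls_X_inv)), temb n 2 2 (B_of_v b)]"

definition refl_eq_rhs :: "nat \<Rightarrow> (nat \<Rightarrow> nat \<Rightarrow> nat \<Rightarrow> 'a::ring_1) \<Rightarrow> 'a fls fps tmat" where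
  "refl_eq_rhs n b = tprod n 2
     [temb n 2 2 (B_of_v b), tR n 2 1 2 (inv_u_minus (- fls_X_inv)),
      temb n 2 1 (B_of_u b), tR n 2 1 2 (inv_u_minus fls_X_inv)]"

text \<open>The \<open>(i, j)\<close> entry of \<open>B(u) B(-u) - 1\<close>.\<close>

definition unitary_defect :: "nat \<Rightarrow> (nat \<Rightarrow> nat \<Rightarrow> nat \<Rightarrow> 'a::ring_1) \<Rightarrow> nat \<Rightarrow> nat \<Rightarrow> 'a fps" where
  "unitary_defect n b i j =
     (\<Sum>a=1..n. Abs_fps (b i a) * (Abs_fps (b a j) oo (- fps_X))) - (if i = j then 1 else 0)"

text \<open>
  The first set eliminates the symbols \<open>(i, j, r)\<close> with \<open>i\<close> or \<open>j\<close> outside \<open>{1..n}\<close>.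
\<close>

definition refl_rels :: "nat \<Rightarrow> nat \<Rightarrow> bsym free_alg set" where
  "refl_rels m l = (let n = m + l in
      {free_b i j r | i j r. i \<notin> {1..n} \<or> j \<notin> {1..n}}
    \<union> {free_b i j 0 - (if i = j then free_scalar (refl_sign m i) else 0) | i j.
         i \<in> {1..n} \<and> j \<in> {1..n}}
    \<union> {fls_nth (fps_nth (refl_eq_lhs n free_b I J - refl_eq_rhs n free_b I J) r) s | I J r s.
         I \<in> tidx n 2 \<and> J \<in> tidx n 2}
    \<union> {fps_nth (unitary_defect n free_b i j) r | i j r. i \<in> {1..n} \<and> j \<in> {1..n}})"



subsection \<open>Consistency of the relations\<close>

text \<open>
  The relations hold for the character \<open>B(u) \<mapsto> diag(\<epsilon>\<^sub>1, \<dots>, \<epsilon>\<^sub>n)\<close>, so that the quotient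
  is not the zero ring.
\<close>

locale two_sided_ideal =
  fixes K :: "'a::ring_1 set"
  assumes zero_mem: "0 \<in> K"
    and add_mem: "x \<in> K \<Longrightarrow> y \<in> K \<Longrightarrow> x + y \<in> K"
    and mult_left_mem: "x \<in> K \<Longrightarrow> a * x \<in> K"
    and mult_right_mem: "x \<in> K \<Longrightarrow> x * a \<in> K"
begin

lemma uminus_mem: "x \<in> K \<Longrightarrow> - x \<in> K"
  using mult_left_mem[of x "-1"] by simp

lemma minus_mem: "x \<in> K \<Longrightarrow> y \<in> K \<Longrightarrow> x - y \<in> K"
  using add_mem[OF _ uminus_mem] by fastforce

lemma sum_mem: "(\<And>i. i \<in> S \<Longrightarrow> f i \<in> K) \<Longrightarrow> sum f S \<in> K"
  by (induction S rule: infinite_finite_induct) (auto simp: zero_mem add_mem)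

lemma mult_cong_mem:
  assumes "a - a' \<in> K" "b - b' \<in> K"
  shows "a * b - a' * b' \<in> K"
proof -
  have "a * b - a' * b' = (a - a') * b + a' * (b - b')"
    by (simp add: algebra_simps)
  then show ?thesis
    using assms by (simp add: add_mem mult_left_mem mult_right_mem)
qed

lemma sum_cong_mem: "(\<And>i. i \<in> S \<Longrightarrow> f i - g i \<in> K) \<Longrightarrow> sum f S - sum g S \<in> K"
  using sum_mem[of S "\<lambda>i. f i - g i"] by (simp add: sum_subtractf)

lemma ideal_gen_subset: "S \<subseteq> K \<Longrightarrow> ideal_gen S \<subseteq> K"
proof
  fix x assume "S \<subseteq> K" "x \<in> ideal_gen S"
  from this(2,1) show "x \<in> K"
    by (induction rule: ideal_gen.induct)
       (auto intro: zero_mem add_mem mult_left_mem mult_right_mem)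
qed

lemma tprod_cong_mem:
  assumes "list_all2 (\<lambda>X Y. \<forall>I J. X I J - Y I J \<in> K) Xs Ys"
  shows "tprod n k Xs I J - tprod n k Ys I J \<in> K"
  using assms
proof (induction arbitrary: I rule: list_all2_induct)
  case Nil
  then show ?case by (simp add: zero_mem)
next
  case (Cons X Xs Y Ys)
  then show ?case
    by (simp add: tprod_def tmult_def sum_cong_mem mult_cong_mem)
qed

lemma fps_ideal: "two_sided_ideal {f. \<forall>r. fps_nth f r \<in> K}"
  by standard
     (auto simp: zero_mem fps_mult_nth add_mem intro!: sum_mem intro: mult_left_mem mult_right_mem)

lemma fls_ideal: "two_sided_ideal {f. \<forall>r. fls_nth f r \<in> K}"
  by standard
     (auto simp: zero_mem fls_times_nth(2) add_mem intro!: sum_mem intro: mult_left_mem mult_right_mem)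

end

lemma permutes_transpose2: "Transposition.transpose (1::nat) 2 permutes {1..2}"
  by (rule permutes_swap_id) auto

lemma tidx_comp: "\<sigma> permutes {1..k} \<Longrightarrow> I \<in> tidx n k \<Longrightarrow> I \<circ> \<sigma> \<in> tidx n k"
  unfolding tidx_def
  by (auto simp: PiE_iff extensional_def permutes_in_image permutes_not_in simp del: atLeastAtMost_iff)

lemma finite_tidx [simp]: "finite (tidx n k)"
  by (simp add: tidx_def finite_PiE)

lemma tmult_tR2:
  assumes "I \<in> tidx n 2"
  shows "tmult n 2 (tR n 2 1 2 g) Y I J = Y I J - g * Y (I \<circ> Transposition.transpose 1 2) J"
proof -
  let ?t = "Transposition.transpose (1::nat) 2"
  have I': "I \<circ> ?t \<in> tidx n 2"
    by (rule tidx_comp[OF permutes_transpose2 assms])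
  have *: "I = K \<circ> ?t \<longleftrightarrow> K = I \<circ> ?t" for K
    by (auto simp: fun_eq_iff)
  have "tmult n 2 (tR n 2 1 2 g) Y I J =
      (\<Sum>K\<in>tidx n 2. (if K = I then Y K J else 0) - (if K = I \<circ> ?t then g * Y K J else 0))"
    unfolding tmult_def tR_def tP_def tperm_def tone_def *
    by (intro sum.cong) (auto simp: left_diff_distrib)
  then show ?thesis
    using assms I' by (simp add: sum_subtractf sum.delta)
qed

lemma tmult_temb_diag:
  assumes "I \<in> tidx n k" "s \<in> {1..k}"
  shows "tmult n k (temb n k s (\<lambda>i j. if i = j then d i else 0)) Y I J = d (I s) * Y I J"
proof -
  have entry: "temb n k s (\<lambda>i j. if i = j then d i else 0) I K = (if K = I then d (I s) else 0)"
    if K: "K \<in> tidx n k" for K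
  proof -
    have "K = I" if "\<forall>t\<in>{1..k} - {s}. I t = K t" "I s = K s"
    proof -
      have "K t = I t" if "t \<in> {1..k}" for t
        using that \<open>\<forall>t\<in>{1..k} - {s}. I t = K t\<close> \<open>I s = K s\<close> by (cases "t = s") auto
      then show "K = I"
        using assms(1) K unfolding tidx_def by (intro PiE_ext)
    qed
    then show ?thesis
      using assms(1) K unfolding temb_def by presburger
  qed
  have "tmult n k (temb n k s (\<lambda>i j. if i = j then d i else 0)) Y I J
      = (\<Sum>K\<in>tidx n k. if K = I then d (I s) * Y I J else 0)"
    unfolding tmult_def by (intro sum.cong refl) (simp add: entry)
  then show ?thesis
    using assms(1) by (simp add: sum.delta)
qed

lemma pm_algebra:
  fixes g h x y a b :: "'a::ring_1"
  assumes "g * h = h * g" "a = 1 \<or> a = -1" "b = 1 \<or> b = -1"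
  shows "a * (b * x - h * (a * y)) - g * (b * (a * y - h * (b * x))) =
         b * (a * (x - g * y) - h * (b * (y - g * x)))"
proof -
  have "g * (h * z) = h * (g * z)" for z
    using assms(1) by (metis mult.assoc)
  then show ?thesis
    using assms(2,3) by (elim disjE) (simp_all add: right_diff_distrib)
qed

lemma refl_eq_diag:
  fixes g h :: "'a::ring_1" and e :: "nat \<Rightarrow> int"
  defines "D \<equiv> \<lambda>i j. if i = j then of_int (e i) else (0::'a)"
  assumes e: "\<And>i. e i = 1 \<or> e i = -1" and gh: "g * h = h * g"
    and I: "I \<in> tidx n 2" and J: "J \<in> tidx n 2"
  shows "tprod n 2 [tR n 2 1 2 g, temb n 2 1 D, tR n 2 1 2 h, temb n 2 2 D] I J =
         tprod n 2 [temb n 2 2 D, tR n 2 1 2 h, temb n 2 1 D, tR n 2 1 2 g] I J"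
proof -
  let ?t = "Transposition.transpose (1::nat) 2"
  have I': "I \<circ> ?t \<in> tidx n 2"
    by (rule tidx_comp[OF permutes_transpose2 I])
  have tt: "I \<circ> ?t \<circ> ?t = I" by (auto simp: fun_eq_iff)
  define d where "d = (\<lambda>i. of_int (e i) :: 'a)"
  have D: "D = (\<lambda>i j. if i = j then d i else 0)"
    unfolding D_def d_def ..
  have d: "d i = 1 \<or> d i = -1" for i
    using e[of i] by (auto simp: d_def)
  define x y where "x = (if I = J then 1 else 0 :: 'a)" and "y = (if I \<circ> ?t = J then 1 else 0 :: 'a)"
  have s1: "tone n 2 K J = (if K = J then 1 else (0 :: 'a))" for K
    using J by (simp add: tone_def)
  have R: "tmult n 2 (tR n 2 1 2 c) Y I J = Y I J - c * Y (I \<circ> ?t) J"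
    and R': "tmult n 2 (tR n 2 1 2 c) Y (I \<circ> ?t) J = Y (I \<circ> ?t) J - c * Y I J" for c :: 'a and Y
    using tmult_tR2[OF I, of c Y J] tmult_tR2[OF I', of c Y J] unfolding tt by blast+
  have D1: "tmult n 2 (temb n 2 1 D) Y I J = d (I 1) * Y I J"
    and D1': "tmult n 2 (temb n 2 1 D) Y (I \<circ> ?t) J = d (I 2) * Y (I \<circ> ?t) J"
    and D2: "tmult n 2 (temb n 2 2 D) Y I J = d (I 2) * Y I J"
    and D2': "tmult n 2 (temb n 2 2 D) Y (I \<circ> ?t) J = d (I 1) * Y (I \<circ> ?t) J" for Y
    unfolding D using I I' by (simp_all add: tmult_temb_diag)
  have *: "foldr f [a, b, c, k] z = f a (f b (f c (f k z)))" for f a b c k and z :: "'a tmat"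
    by simp
  show ?thesis
    unfolding tprod_def * R R' D1 D1' D2 D2' s1 x_def[symmetric] y_def[symmetric]
    by (rule pm_algebra[OF gh d d])
qed

lemma inv_u_minus_commute: "inv_u_minus c * inv_u_minus (- c) = inv_u_minus (- c) * inv_u_minus c"
proof (rule fps_ext)
  fix r
  have comm: "c ^ a * (- c) ^ b = (- c) ^ b * c ^ a" for a b
    by (simp add: uminus_power_if add.commute flip: power_add)
  have "fps_nth (inv_u_minus c * inv_u_minus (- c)) r =
      (\<Sum>i=0..r. fps_nth (inv_u_minus (- c)) (r - i) * fps_nth (inv_u_minus c) i)"
    unfolding fps_mult_nth by (intro sum.cong) (auto simp: inv_u_minus_def comm)
  also have "\<dots> = (\<Sum>i=0..r. fps_nth (inv_u_minus (- c)) i * fps_nth (inv_u_minus c) (r - i))"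
    by (rule sum.reindex_bij_witness[of _ "\<lambda>i. r - i" "\<lambda>i. r - i"]) auto
  finally show "fps_nth (inv_u_minus c * inv_u_minus (- c)) r =
      fps_nth (inv_u_minus (- c) * inv_u_minus c) r"
    by (simp add: fps_mult_nth)
qed

lemma fps_const_compose_ring1: "fps_const c oo g = fps_const (c :: 'a::ring_1)"
proof (rule fps_ext)
  fix r
  have "fps_nth (fps_const c oo g) r = (\<Sum>i=0..r. if i = 0 then c * fps_nth (g ^ 0) r else 0)"
    unfolding fps_compose_def fps_nth_Abs_fps by (intro sum.cong) auto
  then show "fps_nth (fps_const c oo g) r = fps_nth (fps_const c) r"
    by (simp add: sum.delta)
qed

definition char_letter :: "nat \<Rightarrow> nat \<Rightarrow> bsym \<Rightarrow> complex" where
  "char_letter m n = (\<lambda>(i, j, r). if i \<in> {1..n} \<and> i = j \<and> r = 0 then refl_sign m i else 0)"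

definition char_word :: "nat \<Rightarrow> nat \<Rightarrow> bsym fmonoid \<Rightarrow> complex" where
  "char_word m n w = prod_list (map (char_letter m n) (letters w))"

definition free_char :: "nat \<Rightarrow> nat \<Rightarrow> bsym free_alg \<Rightarrow> complex" where
  "free_char m n p = (\<Sum>w\<in>Poly_Mapping.keys p. Poly_Mapping.lookup p w * char_word m n w)"

lemma free_char_superset:
  assumes "finite S" "Poly_Mapping.keys p \<subseteq> S"
  shows "free_char m n p = (\<Sum>w\<in>S. Poly_Mapping.lookup p w * char_word m n w)"
  unfolding free_char_def using assms
  by (intro sum.mono_neutral_left) (auto simp: in_keys_iff)

lemma free_char_add: "free_char m n (p + q) = free_char m n p + free_char m n q"
proof -
  let ?S = "Poly_Mapping.keys p \<union> Poly_Mapping.keys q"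
  have "Poly_Mapping.keys (p + q) \<subseteq> ?S" by (rule keys_add)
  then show ?thesis
    by (simp add: free_char_superset[of ?S] lookup_add algebra_simps sum.distrib)
qed

lemma free_char_single [simp]: "free_char m n (Poly_Mapping.single w c) = c * char_word m n w"
  by (subst free_char_superset[of "{w}"]) auto

lemma free_char_0 [simp]: "free_char m n 0 = 0"
  by (simp add: free_char_def)

lemma free_char_diff: "free_char m n (p - q) = free_char m n p - free_char m n q"
  using free_char_add[of m n "p - q" q] by simp

lemma update_eq_add_single:
  "w \<notin> Poly_Mapping.keys f \<Longrightarrow> Poly_Mapping.update w c f = f + Poly_Mapping.single w c"
  by (rule poly_mapping_eqI) (auto simp: lookup_update lookup_add lookup_single in_keys_iff when_def)

lemma free_char_mult: "free_char m n (p * q) = free_char m n p * free_char m n q"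
proof (induction p rule: update_induct)
  case (update f w c)
  have "free_char m n (Poly_Mapping.single w c * q) = c * char_word m n w * free_char m n q"
  proof (induction q rule: update_induct)
    case (update g v d)
    then show ?case
      by (simp add: update_eq_add_single distrib_left free_char_add mult_single char_word_def
          plus_fmonoid_def)
  qed simp
  with update show ?case
    by (simp add: update_eq_add_single distrib_right free_char_add)
qed simp

lemma free_char_ideal: "two_sided_ideal {p. free_char m n p = 0}"
  by standard (auto simp: free_char_add free_char_mult)

lemma free_char_scalar [simp]: "free_char m n (free_scalar c) = c"
  by (simp add: free_scalar_def char_word_def zero_fmonoid_def)

lemma free_char_b: "free_char m n (free_b i j r) =
    (if i \<in> {1..n} \<and> i = j \<and> r = 0 then refl_sign m i else 0)"
  by (simp add: free_b_def char_word_def char_letter_def)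

definition triv_b :: "nat \<Rightarrow> nat \<Rightarrow> nat \<Rightarrow> nat \<Rightarrow> bsym free_alg" where
  "triv_b m i j r = (if i = j then if r = 0 then of_int (if i \<le> m then 1 else -1) else 0 else 0)"

lemma free_char_of_int [simp]: "free_char m n (of_int k) = of_int k"
  using free_char_scalar[of m n "of_int k"] by (simp add: free_scalar_def)

lemma refl_rels_char: "refl_rels m l \<subseteq> {p. free_char m (m + l) p = 0}"
proof -
  define n where "n = m + l"
  define e :: "nat \<Rightarrow> int" where "e = (\<lambda>i. if i \<le> m then 1 else -1)"
  let ?K = "{p. free_char m n p = 0}"
  interpret K: two_sided_ideal ?K by (rule free_char_ideal)
  interpret Kl: two_sided_ideal "{f. \<forall>r. fls_nth f r \<in> ?K}" by (rule K.fls_ideal)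
  interpret Kp: two_sided_ideal "{f. \<forall>r. fps_nth f r \<in> ?K}" by (rule K.fps_ideal)
  interpret Kpl: two_sided_ideal "{f. \<forall>r. fps_nth f r \<in> {f. \<forall>r. fls_nth f r \<in> ?K}}"
    by (rule Kl.fps_ideal)
  let ?Kpl = "{f. \<forall>r. fps_nth f r \<in> {f. \<forall>r. fls_nth f r \<in> ?K}}"
  define t where "t = triv_b m"
  have bt: "free_b i j r - t i j r \<in> ?K" if "i \<in> {1..n}" "j \<in> {1..n}" for i j r
    using that by (auto simp: t_def free_char_diff free_char_b triv_b_def refl_sign_def)
  define D where "D = (\<lambda>i j. if i = j then of_int (e i) else (0 :: bsym free_alg fls fps))"
  have Du: "B_of_u t = D"
    by (intro ext fps_ext fls_eqI)
       (auto simp: B_of_u_def D_def t_def triv_b_def e_def)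
  have Dv: "B_of_v t = D"
    by (intro ext fps_ext fls_eqI)
       (auto simp: B_of_v_def D_def t_def triv_b_def e_def)
  have embu: "temb n 2 s (B_of_u free_b) I J - temb n 2 s (B_of_u t) I J \<in> ?Kpl"
    if "s \<in> {1..2}" for s I J
  proof (cases "I \<in> tidx n 2 \<and> J \<in> tidx n 2")
    case True
    then have "I s \<in> {1..n}" "J s \<in> {1..n}" using that by (auto simp: tidx_def PiE_iff)
    then show ?thesis using bt by (auto simp: temb_def B_of_u_def)
  qed (auto simp: temb_def)
  have embv: "temb n 2 s (B_of_v free_b) I J - temb n 2 s (B_of_v t) I J \<in> ?Kpl"
    if "s \<in> {1..2}" for s I J
  proof (cases "I \<in> tidx n 2 \<and> J \<in> tidx n 2")
    case True
    then have "I s \<in> {1..n}" "J s \<in> {1..n}" using that by (auto simp: tidx_def PiE_iff)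
    then show ?thesis using bt by (auto simp: temb_def B_of_v_def)
  qed (auto simp: temb_def)
  have lhs: "refl_eq_lhs n free_b I J - refl_eq_lhs n t I J \<in> ?Kpl" for I J
    unfolding refl_eq_lhs_def
    by (rule Kpl.tprod_cong_mem, intro list.rel_intros allI embu embv) auto
  have rhs: "refl_eq_rhs n free_b I J - refl_eq_rhs n t I J \<in> ?Kpl" for I J
    unfolding refl_eq_rhs_def
    by (rule Kpl.tprod_cong_mem, intro list.rel_intros allI embu embv) auto
  have mid: "refl_eq_lhs n t I J = refl_eq_rhs n t I J" if "I \<in> tidx n 2" "J \<in> tidx n 2" for I J
    unfolding refl_eq_lhs_def refl_eq_rhs_def Du Dv D_def
    by (rule refl_eq_diag) (auto simp: e_def that inv_u_minus_commute)
  have refl: "refl_eq_lhs n free_b I J - refl_eq_rhs n free_b I J \<in> ?Kpl"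
    if "I \<in> tidx n 2" "J \<in> tidx n 2" for I J
    using Kpl.minus_mem[OF lhs[of I J] rhs[of I J]] mid[OF that] by simp
  have comp: "(f oo (- fps_X)) - (g oo (- fps_X)) \<in> {f. \<forall>r. fps_nth f r \<in> ?K}"
    if "f - g \<in> {f. \<forall>r. fps_nth f r \<in> ?K}" for f g
  proof -
    have "fps_nth (f oo (- fps_X)) r - fps_nth (g oo (- fps_X)) r \<in> ?K" for r
      unfolding fps_compose_def fps_nth_Abs_fps
      using that by (intro K.sum_cong_mem K.mult_cong_mem) auto
    then show ?thesis by simp
  qed
  have unit: "unitary_defect n free_b i j \<in> {f. \<forall>r. fps_nth f r \<in> ?K}"
    if ij: "i \<in> {1..n}" "j \<in> {1..n}" for i j
  proof -
    have "unitary_defect n free_b i j - unitary_defect n t i j =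
      (\<Sum>a=1..n. Abs_fps (free_b i a) * (Abs_fps (free_b a j) oo (- fps_X))) -
      (\<Sum>a=1..n. Abs_fps (t i a) * (Abs_fps (t a j) oo (- fps_X)))"
      by (simp add: unitary_defect_def)
    also have "\<dots> \<in> {f. \<forall>r. fps_nth f r \<in> ?K}"
      using bt ij by (intro Kp.sum_cong_mem Kp.mult_cong_mem comp) auto
    finally have 1: "unitary_defect n free_b i j - unitary_defect n t i j \<in> \<dots>" .
    have tc: "Abs_fps (t a b) = fps_const (if a = b then of_int (e a) else 0)" for a b
      by (rule fps_ext) (auto simp: t_def triv_b_def e_def)
    have "unitary_defect n t i j = 
      (\<Sum>a=1..n. if a = i then (if i = j then 1 else 0) else 0) - (if i = j then 1 else 0)"
      unfolding unitary_defect_def tc fps_const_compose_ring1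
      by (intro arg_cong2[where f = "(-)"] sum.cong refl) (auto simp: e_def)
    also have "\<dots> = 0" using ij by (simp add: sum.delta)
    finally show ?thesis using 1 by simp
  qed
  have surplus: "free_b i j r \<in> ?K" if "i \<notin> {1..n} \<or> j \<notin> {1..n}" for i j r
    using that by (auto simp: free_char_b)
  have const: "free_b i j 0 - (if i = j then free_scalar (refl_sign m i) else 0) \<in> ?K"
    if "i \<in> {1..n}" "j \<in> {1..n}" for i j
    using that by (simp add: free_char_diff free_char_b)
  have refl': "fls_nth (fps_nth (refl_eq_lhs n free_b I J - refl_eq_rhs n free_b I J) r) s \<in> ?K"
    if "I \<in> tidx n 2" "J \<in> tidx n 2" for I J r s
    using refl[OF that] by blast
  have unit': "fps_nth (unitary_defect n free_b i j) r \<in> ?K"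
    if "i \<in> {1..n}" "j \<in> {1..n}" for i j r
    using unit[OF that] by blast
  show ?thesis
    unfolding refl_rels_def Let_def n_def[symmetric]
    using surplus const refl' unit' by (intro Un_least) blast+
qed

lemma one_notin_ideal: "1 \<notin> ideal_gen (refl_rels m l)"
proof
  interpret two_sided_ideal "{p. free_char m (m + l) p = 0}" by (rule free_char_ideal)
  assume "1 \<in> ideal_gen (refl_rels m l)"
  then have "free_char m (m + l) 1 = 0"
    using ideal_gen_subset[OF refl_rels_char] by auto
  then show False
    using free_char_of_int[of m "m + l" 1] by simp
qed


subsection \<open>The quotient\<close>

text \<open>
  \<open>('m, 'l) refl_alg\<close> is the algebra \<open>B(n,l)\<close> with \<open>m = LENGTH('m)\<close>, \<open>l = LENGTH('l)\<close> and
  \<open>n = m + l\<close>; numeral types, including \<open>0\<close>, provide every pair \<open>(m, l)\<close>.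
\<close>

quotient_type (overloaded) ('m, 'l) refl_alg =
  "bsym free_alg" / "\<lambda>x y. x - y \<in> ideal_gen (refl_rels LENGTH('m::len0) LENGTH('l::len0))"
proof (intro equivpI reflpI sympI transpI)
  let ?I = "ideal_gen (refl_rels LENGTH('m) LENGTH('l))"
  show "x - x \<in> ?I" for x by (simp add: ideal_gen.zero)
  show "y - x \<in> ?I" if "x - y \<in> ?I" for x y
    using ideal_gen_uminus[OF that] by simp
  show "x - z \<in> ?I" if "x - y \<in> ?I" "y - z \<in> ?I" for x y z
    using ideal_gen_add[OF that] by simp
qed

instantiation refl_alg :: (len0, len0) ring_1
begin

lift_definition zero_refl_alg :: "('a, 'b) refl_alg" is 0 .

lift_definition one_refl_alg :: "('a, 'b) refl_alg" is 1 .

lift_definition plus_refl_alg :: "('a, 'b) refl_alg \<Rightarrow> ('a, 'b) refl_alg \<Rightarrow> ('a, 'b) refl_alg"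
  is "(+)"
  unfolding add_diff_add by (rule ideal_gen_add)

lift_definition minus_refl_alg :: "('a, 'b) refl_alg \<Rightarrow> ('a, 'b) refl_alg \<Rightarrow> ('a, 'b) refl_alg"
  is "(-)"
proof -
  fix x x' y y' :: "bsym free_alg"
  let ?I = "ideal_gen (refl_rels LENGTH('a) LENGTH('b))"
  assume "x - x' \<in> ?I" "y - y' \<in> ?I"
  then have "(x - x') - (y - y') \<in> ?I" by (rule ideal_gen_minus)
  then show "x - y - (x' - y') \<in> ?I" by (simp add: algebra_simps)
qed

lift_definition uminus_refl_alg :: "('a, 'b) refl_alg \<Rightarrow> ('a, 'b) refl_alg"
  is uminus
  unfolding minus_diff_minus by (rule ideal_gen_uminus)

lift_definition times_refl_alg :: "('a, 'b) refl_alg \<Rightarrow> ('a, 'b) refl_alg \<Rightarrow> ('a, 'b) refl_alg"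
  is "(*)"
proof -
  fix x x' y y' :: "bsym free_alg"
  let ?I = "ideal_gen (refl_rels LENGTH('a) LENGTH('b))"
  assume "x - x' \<in> ?I" "y - y' \<in> ?I"
  then have "(x - x') * y + x' * (y - y') \<in> ?I"
    by (intro ideal_gen_add ideal_gen_mult_left ideal_gen_mult_right)
  then show "x * y - x' * y' \<in> ?I" by (simp add: algebra_simps)
qed

instance
proof
  show "(0 :: ('a, 'b) refl_alg) \<noteq> 1"
    by transfer (use one_notin_ideal ideal_gen_uminus in fastforce)
qed (transfer; simp add: algebra_simps ideal_gen.zero)+

end

lift_definition refl_scalar :: "complex \<Rightarrow> ('m::len0, 'l::len0) refl_alg" is free_scalar .

lift_definition refl_b :: "nat \<Rightarrow> nat \<Rightarrow> nat \<Rightarrow> ('m::len0, 'l::len0) refl_alg" is free_b .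

definition B_series :: "nat \<Rightarrow> nat \<Rightarrow> ('m::len0, 'l::len0) refl_alg fps" where
  "B_series i j = Abs_fps (refl_b i j)"


section \<open>The Sklyanin determinant\<close>

text \<open>\<open>B\<^sub>s(u - c)\<close> on \<open>n\<close> tensor factors.\<close>

definition B_op :: "nat \<Rightarrow> nat \<Rightarrow> nat \<Rightarrow> ('m::len0, 'l::len0) refl_alg fps tmat" where
  "B_op n s c = temb n n s (\<lambda>i j. B_series i j oo inv_u_minus (of_nat c))"

text \<open>\<open>1/(2u - c) = 1/2 \<cdot> 1/(u - c/2)\<close>\<close>

definition inv_2u_minus :: "complex \<Rightarrow> ('m::len0, 'l::len0) refl_alg fps" where
  "inv_2u_minus c = fps_const (refl_scalar (1/2)) * inv_u_minus (refl_scalar (c/2))"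

definition R_op :: "nat \<Rightarrow> nat \<Rightarrow> nat \<Rightarrow> ('m::len0, 'l::len0) refl_alg fps tmat" where
  "R_op n i j = tR n n i j (inv_2u_minus (of_nat i + of_nat j - 2))"

definition Pi_op :: "nat \<Rightarrow> nat \<Rightarrow> ('m::len0, 'l::len0) refl_alg fps tmat" where
  "Pi_op n k = (\<lambda>I J. tone n n I J -
     inv_2u_minus (of_nat k + of_nat n - 2) * (\<Sum>i=k+1..n. tP n n k i I J))"

definition sbracket :: "nat \<Rightarrow> ('m::len0, 'l::len0) refl_alg fps tmat" where
  "sbracket n = tprod n n
     (concat (map (\<lambda>k. B_op n k (k - 1) # map (\<lambda>j. R_op n k j) [k+1..<n+1]) [1..<n+1]))"

definition sbracket2 :: "nat \<Rightarrow> ('m::len0, 'l::len0) refl_alg fps tmat" where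
  "sbracket2 n = tprod n n
     (concat (map (\<lambda>k. B_op n k (k - 1) # (if k < n then [Pi_op n k] else [])) [1..<n+1]))"

definition sdet :: "('m::len0, 'l::len0) refl_alg fps" where
  "sdet = (let n = LENGTH('m) + LENGTH('l) in
     THE s. tmult n n (antisymmetrizer n) (sbracket n) = tscale s (antisymmetrizer n))"

end

theory Submission
  imports Defs
begin

text \<open>
  The rows of the antisymmetrizer are row vectors that alternate in all tensor positions, and
  operators act on them from the right.

  A row vector that alternates in the positions \<open>k + 1, \<dots>, n\<close> satisfies
  \<open>f P\<^sub>k\<^sub>i P\<^sub>k\<^sub>j = f P\<^sub>i\<^sub>j P\<^sub>k\<^sub>i = - f P\<^sub>k\<^sub>i\<close>, so that \<open>f R\<^sub>k\<^sub>,\<^sub>k\<^sub>+\<^sub>1 \<dots> R\<^sub>k\<^sub>n\<close> telescopes to \<open>f \<Pi>\<^sub>k\<close>;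
  moreover \<open>f B\<^sub>k\<close> and \<open>f \<Pi>\<^sub>k\<close> still alternate in these positions. Hence both brackets agree
  after multiplication by the antisymmetrizer.

  For the existence of the Sklyanin determinant, right multiplication by the bracket preserves the
  vectors that alternate in \<open>i, i + 1\<close>: these are the image of \<open>1 - P = R(1)\<close>, which passes through
  the pairs \<open>R\<^sub>k\<^sub>i R\<^sub>k\<^sub>,\<^sub>i\<^sub>+\<^sub>1\<close> by the Yang--Baxter equation and through \<open>B\<^sub>i R\<^sub>i\<^sub>,\<^sub>i\<^sub>+\<^sub>1 B\<^sub>i\<^sub>+\<^sub>1\<close> by the
  reflection equation. A matrix that alternates in both multi-indices is a multiple of the
  antisymmetrizer.

  The reflection equation is imposed on expansions in \<open>v/u\<close>, where \<open>v = u - 1\<close> cannot be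
  substituted. One first multiplies by \<open>1 - v\<^sup>2 u\<^sup>-\<^sup>2\<close> to clear the denominators, substitutes series
  for \<open>u\<^sup>-\<^sup>1\<close> and \<open>v\<^sup>-\<^sup>1\<close>, and then cancels a nonzero scalar series.
\<close>

section \<open>Central elements and substitution into double series\<close>

text \<open>The coefficient ring is noncommutative; this predicate records which elements and
  series, such as the expansions of \<open>1/(u - c)\<close>, may be moved past matrix
  entries.\<close>

definition central :: "'a::ring_1 \<Rightarrow> bool" where
  "central z \<longleftrightarrow> (\<forall>x. z * x = x * z)"

lemma centralD: "central z \<Longrightarrow> z * x = x * z"
  by (simp add: central_def)

lemma central_left_commute: "central z \<Longrightarrow> x * (z * y) = z * (x * y)"
  by (metis centralD mult.assoc)

lemma central_0 [simp]: "central 0" and central_1 [simp]: "central 1"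
  by (simp_all add: central_def)

lemma central_of_int [simp]: "central (of_int k)"
  by (simp add: central_def mult_of_int_commute)

lemma central_uminus: "central x \<Longrightarrow> central (- x)"
  by (simp add: central_def)

lemma central_mult: "central x \<Longrightarrow> central y \<Longrightarrow> central (x * y)"
  by (metis central_def mult.assoc)

lemma central_power: "central x \<Longrightarrow> central (x ^ k)"
  by (induction k) (simp_all add: central_mult)

text \<open>Testing against constant series gives one direction; reversing the convolution sum gives
  the other.\<close>

lemma central_fps_iff: "central f \<longleftrightarrow> (\<forall>k. central (fps_nth f k))"
proof
  assume f: "central f"
  show "\<forall>k. central (fps_nth f k)"
    unfolding central_def
  proof (intro allI)
    fix k x
    have "fps_nth (f * fps_const x) k = fps_nth (fps_const x * f) k"
      using f by (simp only: central_def)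
    then show "fps_nth f k * x = x * fps_nth f k" by simp
  qed
next
  assume f: "\<forall>k. central (fps_nth f k)"
  show "central f"
    unfolding central_def
  proof (intro allI fps_ext)
    fix g k
    have "fps_nth (f * g) k = (\<Sum>i=0..k. fps_nth g (k - i) * fps_nth f i)"
      unfolding fps_mult_nth using f by (intro sum.cong) (auto intro: centralD)
    also have "\<dots> = fps_nth (g * f) k"
      unfolding fps_mult_nth by (rule sum.reindex_bij_witness[of _ "\<lambda>i. k - i" "\<lambda>i. k - i"]) auto
    finally show "fps_nth (f * g) k = fps_nth (g * f) k" .
  qed
qed

lemma central_fps_const: "central c \<Longrightarrow> central (fps_const c)"
  by (simp add: central_fps_iff)

lemma central_fps_X [simp]: "central fps_X"
  by (simp add: central_fps_iff fps_X_def)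

lemma central_inv_u_minus: "central c \<Longrightarrow> central (inv_u_minus c)"
  by (simp add: central_fps_iff inv_u_minus_def central_power)

section \<open>Values of double series at two power series without constant term\<close>

lemma sum_rotate: "(\<Sum>a\<in>A. \<Sum>b\<in>B. \<Sum>c\<in>C. f a b c) = (\<Sum>b\<in>B. \<Sum>c\<in>C. \<Sum>a\<in>A. f a b c)"
proof -
  have "(\<Sum>a\<in>A. \<Sum>b\<in>B. \<Sum>c\<in>C. f a b c) = (\<Sum>b\<in>B. \<Sum>a\<in>A. \<Sum>c\<in>C. f a b c)"
    by (rule sum.swap)
  then show ?thesis by (simp add: sum.swap[of _ C A])
qed

text \<open>In every summand of the convolution one factor vanishes, as \<open>g ^ r\<close> and
  \<open>h ^ s\<close> start in degrees \<open>r\<close> and \<open>s\<close> at the earliest. This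
  makes the substitution in \<open>eval2\<close> finite in each degree.\<close>

lemma fps_power_mult_nth_eq_0:
  fixes g h :: "'a::ring_1 fps"
  assumes "fps_nth g 0 = 0" "fps_nth h 0 = 0" "N < r + s"
  shows "fps_nth (g ^ r * h ^ s) N = 0"
  unfolding fps_mult_nth
proof (rule sum.neutral, rule ballI)
  fix k assume "k \<in> {0..N}"
  then have "k < r \<or> N - k < s" using assms(3) by auto
  then show "fps_nth (g ^ r) k * fps_nth (h ^ s) (N - k) = 0"
    using startsby_zero_power_prefix[of g r] startsby_zero_power_prefix[of h s] assms(1,2) by auto
qed

text \<open>The value at \<open>x = g\<close>, \<open>y = h\<close> of the double series with
  coefficient \<open>G r s\<close> at \<open>x^r y^s\<close>, coefficients kept on the left. Cutting
  both sums at \<open>N\<close> loses nothing when \<open>g\<close> and \<open>h\<close> have no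
  constant term.\<close>

definition eval2 :: "'a::ring_1 fps \<Rightarrow> 'a fps \<Rightarrow> (nat \<Rightarrow> nat \<Rightarrow> 'a) \<Rightarrow> 'a fps" where
  "eval2 g h G = Abs_fps (\<lambda>N. \<Sum>r\<le>N. \<Sum>s\<le>N. G r s * fps_nth (g ^ r * h ^ s) N)"

lemma eval2_add: "eval2 g h (\<lambda>r s. G r s + H r s) = eval2 g h G + eval2 g h H"
  by (rule fps_ext) (simp add: eval2_def distrib_right sum.distrib)

lemma eval2_diff: "eval2 g h (\<lambda>r s. G r s - H r s) = eval2 g h G - eval2 g h H"
  by (rule fps_ext) (simp add: eval2_def left_diff_distrib sum_subtractf)

lemma eval2_0: "eval2 g h (\<lambda>r s. 0) = 0"
  by (rule fps_ext) (simp add: eval2_def)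

context
  fixes g h :: "'a::ring_1 fps"
  assumes g0: "fps_nth g 0 = 0" and h0: "fps_nth h 0 = 0"
begin

text \<open>The extra terms have order above \<open>N\<close>. Independent bounds are what the index
  shifts in \<open>eval2_shift\<close> call for.\<close>

lemma eval2_nth_bound:
  assumes "N \<le> M" "N \<le> M'"
  shows "fps_nth (eval2 g h G) N = (\<Sum>r\<le>M. \<Sum>s\<le>M'. G r s * fps_nth (g ^ r * h ^ s) N)"
proof -
  have "(\<Sum>s\<le>M'. G r s * fps_nth (g ^ r * h ^ s) N) = (\<Sum>s\<le>N. G r s * fps_nth (g ^ r * h ^ s) N)" for r
    using assms by (intro sum.mono_neutral_right) (auto simp: fps_power_mult_nth_eq_0[OF g0 h0])
  moreover have "(\<Sum>r\<le>M. \<Sum>s\<le>N. G r s * fps_nth (g ^ r * h ^ s) N) =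
      (\<Sum>r\<le>N. \<Sum>s\<le>N. G r s * fps_nth (g ^ r * h ^ s) N)"
    using assms by (intro sum.mono_neutral_right) (auto simp: fps_power_mult_nth_eq_0[OF g0 h0])
  ultimately show ?thesis by (simp add: eval2_def)
qed

lemma fps_compose_nth_bound:
  assumes "fps_nth f 0 = 0" "k \<le> N"
  shows "fps_nth (c oo f) k = (\<Sum>r\<le>N. fps_nth c r * fps_nth (f ^ r :: 'a fps) k)"
  unfolding fps_compose_nth using assms
  by (intro sum.mono_neutral_left) (auto simp: startsby_zero_power_prefix)

text \<open>Each \<open>d s\<close> has to pass a coefficient of a power of \<open>g\<close>, hence
  the centrality of \<open>g\<close>; the powers of \<open>h\<close> already stand on the
  right.\<close>

lemma eval2_mult:
  assumes "central g"
  shows "eval2 g h (\<lambda>r s. c r * d s) = (Abs_fps c oo g) * (Abs_fps d oo h)"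
proof (rule fps_ext)
  fix N
  have cg: "central (fps_nth (g ^ r) k)" for r k
    using central_power[OF assms, of r] by (simp add: central_fps_iff)
  have "fps_nth ((Abs_fps c oo g) * (Abs_fps d oo h)) N =
      (\<Sum>k=0..N. (\<Sum>r\<le>N. c r * fps_nth (g ^ r) k) * (\<Sum>s\<le>N. d s * fps_nth (h ^ s) (N - k)))"
    unfolding fps_mult_nth
    by (intro sum.cong) (auto simp: fps_compose_nth_bound[OF g0, of _ N] fps_compose_nth_bound[OF h0, of _ N])
  also have "\<dots> = (\<Sum>k=0..N. \<Sum>r\<le>N. \<Sum>s\<le>N. c r * d s * (fps_nth (g ^ r) k * fps_nth (h ^ s) (N - k)))"
    by (simp add: sum_product mult.assoc central_left_commute[OF cg])
  also have "\<dots> = (\<Sum>r\<le>N. \<Sum>s\<le>N. \<Sum>k=0..N. c r * d s * (fps_nth (g ^ r) k * fps_nth (h ^ s) (N - k)))"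
    by (rule sum_rotate)
  also have "\<dots> = fps_nth (eval2 g h (\<lambda>r s. c r * d s)) N"
    by (simp add: eval2_def fps_mult_nth sum_distrib_left)
  finally show "fps_nth (eval2 g h (\<lambda>r s. c r * d s)) N = fps_nth ((Abs_fps c oo g) * (Abs_fps d oo h)) N" ..
qed

text \<open>The coefficients on the left are those of the double series multiplied by the monomial
  \<open>x^p y^q\<close>.\<close>

lemma eval2_shift:
  assumes cg: "central g" and ch: "central h"
  shows "eval2 g h (\<lambda>r s. if p \<le> r \<and> q \<le> s then G (r - p) (s - q) else 0) = g ^ p * h ^ q * eval2 g h G"
    (is "eval2 g h ?H = _")
proof (rule fps_ext)
  fix N
  have c: "central (fps_nth (g ^ p * h ^ q) k)" for k
    using central_mult[OF central_power[OF cg] central_power[OF ch], of p q] by (simp add: central_fps_iff)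
  have gh: "g ^ p * h ^ q * (g ^ r * h ^ s) = g ^ (r + p) * h ^ (s + q)" for r s
  proof -
    have "g ^ p * h ^ q * (g ^ r * h ^ s) = (g ^ p * g ^ r) * (h ^ q * h ^ s)"
      by (simp only: mult.assoc central_left_commute[OF central_power[OF cg], of "h ^ q" r])
    then show ?thesis by (simp add: add.commute flip: power_add)
  qed
  have "fps_nth (g ^ p * h ^ q * eval2 g h G) N = 
     (\<Sum>k=0..N. fps_nth (g ^ p * h ^ q) k * (\<Sum>r\<le>N. \<Sum>s\<le>N. G r s * fps_nth (g ^ r * h ^ s) (N - k)))"
    unfolding fps_mult_nth[of "g ^ p * h ^ q"] by (intro sum.cong refl) (simp add: eval2_nth_bound[of _ N N])
  also have "\<dots> = (\<Sum>k=0..N. \<Sum>r\<le>N. \<Sum>s\<le>N. G r s * (fps_nth (g ^ p * h ^ q) k * fps_nth (g ^ r * h ^ s) (N - k)))"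
    by (simp add: sum_distrib_left central_left_commute[OF c])
  also have "\<dots> = (\<Sum>r\<le>N. \<Sum>s\<le>N. \<Sum>k=0..N. G r s * (fps_nth (g ^ p * h ^ q) k * fps_nth (g ^ r * h ^ s) (N - k)))"
    by (rule sum_rotate)
  also have "\<dots> = (\<Sum>r\<le>N. \<Sum>s\<le>N. G r s * fps_nth (g ^ p * h ^ q * (g ^ r * h ^ s)) N)"
    by (simp add: fps_mult_nth[of "g ^ p * h ^ q"] sum_distrib_left)
  also have "\<dots> = (\<Sum>r\<le>N. \<Sum>s\<le>N. G r s * fps_nth (g ^ (r + p) * h ^ (s + q)) N)"
    by (simp only: gh)
  \<comment> \<open>After the shift the indices run up to \<open>N + p\<close> and
    \<open>N + q\<close>; \<open>eval2_nth_bound\<close> permits these larger bounds.\<close>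
  also have "\<dots> = (\<Sum>r\<in>{p..N+p}. \<Sum>s\<in>{q..N+q}. G (r - p) (s - q) * fps_nth (g ^ r * h ^ s) N)"
    by (rule sum.reindex_bij_witness[of _ "\<lambda>r. r - p" "\<lambda>r. r + p"],
        auto intro!: sum.reindex_bij_witness[of _ "\<lambda>r. r + q" "\<lambda>r. r - q"])
  also have "\<dots> = (\<Sum>r\<in>{p..N+p}. \<Sum>s\<le>N+q. ?H r s * fps_nth (g ^ r * h ^ s) N)"
    by (intro sum.cong refl sum.mono_neutral_cong_left) auto
  also have "\<dots> = (\<Sum>r\<le>N+p. \<Sum>s\<le>N+q. ?H r s * fps_nth (g ^ r * h ^ s) N)"
    by (intro sum.mono_neutral_left) auto
  also have "\<dots> = fps_nth (eval2 g h ?H) N"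
    by (simp add: eval2_nth_bound[of N "N + p" "N + q"])
  finally show "fps_nth (eval2 g h ?H) N = fps_nth (g ^ p * h ^ q * eval2 g h G) N" ..
qed

end

text \<open>For coefficients multiplied in the opposite order, the roles of \<open>g\<close> and
  \<open>h\<close> are exchanged.\<close>

lemma eval2_mult_commuted:
  assumes "fps_nth g 0 = 0" "fps_nth h 0 = 0" "central g" "central h"
  shows "eval2 g h (\<lambda>r s. d s * c r) = (Abs_fps d oo h) * (Abs_fps c oo g)"
proof -
  have "eval2 g h (\<lambda>r s. d s * c r) = eval2 h g (\<lambda>r s. d r * c s)"
    unfolding eval2_def
    by (subst sum.swap) (simp only: centralD[OF central_power[OF assms(4)]])
  then show ?thesis using eval2_mult[OF assms(2,1,4)] by simp
qed

section \<open>The reflection equation at shifted arguments\<close>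

declare One_nat_def [simp del]

section \<open>Entries of the two sides of the reflection equation\<close>

lemma tidx_upd: "I \<in> tidx n k \<Longrightarrow> s \<in> {1..k} \<Longrightarrow> a \<in> {1..n} \<Longrightarrow> I(s := a) \<in> tidx n k"
  by (auto simp: tidx_def PiE_iff extensional_def)

lemma sum_temb_index:
  assumes I: "I \<in> tidx n k" and s: "s \<in> {1..k}"
  shows "(\<Sum>K | K \<in> tidx n k \<and> (\<forall>t\<in>{1..k} - {s}. I t = K t). F K) = (\<Sum>a=1..n. F (I(s := a)))"
proof (rule sum.reindex_bij_witness[of _ "\<lambda>a. I(s := a)" "\<lambda>K. K s"])
  fix K assume K: "K \<in> {K. K \<in> tidx n k \<and> (\<forall>t\<in>{1..k} - {s}. I t = K t)}"
  show *: "I(s := K s) = K"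
  proof
    fix t
    show "(I(s := K s)) t = K t"
      using K I s by (cases "t \<in> {1..k}") (auto simp: tidx_def PiE_iff extensional_def)
  qed
  show "K s \<in> {1..n}" using K s by (auto simp: tidx_def PiE_iff)
  show "F (I(s := K s)) = F K" by (simp only: *)
qed (use assms in \<open>auto intro: tidx_upd\<close>)

lemma tmult_temb:
  fixes X :: "nat \<Rightarrow> nat \<Rightarrow> 'a::semiring_0"
  assumes I: "I \<in> tidx n k" and s: "s \<in> {1..k}"
  shows "tmult n k (temb n k s X) Y I J = (\<Sum>a=1..n. X (I s) a * Y (I(s := a)) J)"
proof -
  have "tmult n k (temb n k s X) Y I J =
      (\<Sum>K | K \<in> tidx n k \<and> (\<forall>t\<in>{1..k} - {s}. I t = K t). X (I s) (K s) * Y K J)"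
    unfolding tmult_def using I
    by (intro sum.mono_neutral_cong_right) (auto simp: temb_def)
  then show ?thesis
    by (simp add: sum_temb_index[OF assms])
qed

lemma tidx2_eq_iff:
  assumes "I \<in> tidx n 2" "J \<in> tidx n 2"
  shows "I = J \<longleftrightarrow> I 1 = J 1 \<and> I 2 = J 2"
proof
  assume *: "I 1 = J 1 \<and> I 2 = J 2"
  have "I t = J t" if "t \<in> {1..2}" for t
  proof -
    have "t = 1 \<or> t = 2" using that by (simp; linarith)
    then show ?thesis using * by blast
  qed
  then show "I = J" using assms unfolding tidx_def by (intro PiE_ext)
qed simp

lemma tidx_range: "I \<in> tidx n k \<Longrightarrow> s \<in> {1..k} \<Longrightarrow> I s \<in> {1..n}"
  by (auto simp: tidx_def PiE_iff)

lemma tmult_tone_right: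
  fixes X :: "'a::ring_1 tmat"
  shows "tmult n k X (tone n k) I J = (if J \<in> tidx n k then X I J else 0)"
proof -
  have "tmult n k X (tone n k) I J = (\<Sum>K\<in>tidx n k. if K = J then if J \<in> tidx n k then X I J else 0 else 0)"
    unfolding tmult_def tone_def by (intro sum.cong) auto
  then show ?thesis by (simp add: sum.delta)
qed

lemma one_in_1_2: "1 \<in> {1..2::nat}" and two_in_1_2: "2 \<in> {1..2::nat}"
  by simp_all

text \<open>The factors are applied from the right; \<open>P\<close> permutes the row index, so each
  \<open>R\<close> yields two terms. Where the swap contracts the two matrices, a sum over
  \<open>c\<close> appears. The scalar \<open>b\<close> has to pass an entry of \<open>U\<close>,
  while \<open>a\<close> already stands in front.\<close>

lemma refl_lhs_entries:
  fixes U V :: "nat \<Rightarrow> nat \<Rightarrow> 'a::ring_1"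
  assumes I: "I \<in> tidx n 2" and J: "J \<in> tidx n 2" and c: "central b"
  shows "tprod n 2 [tR n 2 1 2 a, temb n 2 1 U, tR n 2 1 2 b, temb n 2 2 V] I J =
    U (I 1) (J 1) * V (I 2) (J 2) - a * (U (I 2) (J 1) * V (I 1) (J 2))
    - (if I 2 = J 1 then b * (\<Sum>c=1..n. U (I 1) c * V c (J 2)) else 0)
    + (if I 1 = J 1 then a * (b * (\<Sum>c=1..n. U (I 2) c * V c (J 2))) else 0)"
proof -
  let ?t = "Transposition.transpose (1::nat) 2"
  let ?Y = "tmult n 2 (tR n 2 1 2 b) (tmult n 2 (temb n 2 2 V) (tone n 2))"
  have t: "K \<circ> ?t \<in> tidx n 2" if "K \<in> tidx n 2" for K
    by (rule tidx_comp[OF permutes_transpose2 that])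
  have V: "temb n 2 2 V K J = (if K 1 = J 1 then V (K 2) (J 2) else 0)" if "K \<in> tidx n 2" for K
  proof -
    have "{1..2} - {2::nat} = {1}" by auto
    then show ?thesis using that J by (simp add: temb_def)
  qed
  have Y: "?Y K J = (if K 1 = J 1 then V (K 2) (J 2) else 0) - b * (if K 2 = J 1 then V (K 1) (J 2) else 0)"
    if "K \<in> tidx n 2" for K
    using that J t[OF that] by (simp add: tmult_tR2 tmult_tone_right V)
  have X: "tmult n 2 (temb n 2 1 U) ?Y K J =
      U (K 1) (J 1) * V (K 2) (J 2) - (if K 2 = J 1 then b * (\<Sum>c=1..n. U (K 1) c * V c (J 2)) else 0)"
    if K: "K \<in> tidx n 2" for K
  proof -
    have "tmult n 2 (temb n 2 1 U) ?Y K J =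
       (\<Sum>c=1..n. (if c = J 1 then U (K 1) (J 1) * V (K 2) (J 2) else 0)
          - (if K 2 = J 1 then b * (U (K 1) c * V c (J 2)) else 0))"
      unfolding tmult_temb[OF K one_in_1_2]
      by (intro sum.cong refl) (auto simp: Y tidx_upd[OF K] right_diff_distrib central_left_commute[OF c])
    also have "\<dots> = U (K 1) (J 1) * V (K 2) (J 2) - (if K 2 = J 1 then b * (\<Sum>c=1..n. U (K 1) c * V c (J 2)) else 0)"
      using tidx_range[OF J, of 1] by (simp add: sum_subtractf sum.delta sum_distrib_left)
    finally show ?thesis .
  qed
  show ?thesis
    unfolding tprod_def list.map foldr.simps o_apply id_apply
    using X[OF I] X[OF t[OF I]]
    by (simp add: tmult_tR2[OF I] right_diff_distrib)
qed

text \<open>On this side both scalars stand behind entries of \<open>V\<close>, so both have to be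
  central.\<close>

lemma refl_rhs_entries:
  fixes U V :: "nat \<Rightarrow> nat \<Rightarrow> 'a::ring_1"
  assumes I: "I \<in> tidx n 2" and J: "J \<in> tidx n 2" and a: "central a" and b: "central b"
  shows "tprod n 2 [temb n 2 2 V, tR n 2 1 2 b, temb n 2 1 U, tR n 2 1 2 a] I J =
    V (I 2) (J 2) * U (I 1) (J 1) - a * (V (I 2) (J 1) * U (I 1) (J 2))
    - (if I 1 = J 2 then b * (\<Sum>c=1..n. V (I 2) c * U c (J 1)) else 0)
    + (if I 1 = J 1 then a * (b * (\<Sum>c=1..n. V (I 2) c * U c (J 2))) else 0)"
proof -
  let ?t = "Transposition.transpose (1::nat) 2"
  let ?Y = "tmult n 2 (temb n 2 1 U) (tmult n 2 (tR n 2 1 2 a) (tone n 2))"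
  have t: "K \<circ> ?t \<in> tidx n 2" if "K \<in> tidx n 2" for K
    by (rule tidx_comp[OF permutes_transpose2 that])
  have Ua: "U i j * a = a * U i j" and Va: "V i j * (a * y) = a * (V i j * y)"
    and Vb: "V i j * (b * y) = b * (V i j * y)" and ab: "b * (a * y) = a * (b * y)" for i j y
    by (metis a b centralD mult.assoc)+
  have one: "tone n 2 K J = (if K 1 = J 1 \<and> K 2 = J 2 then 1 else (0::'a))" if "K \<in> tidx n 2" for K
    using tidx2_eq_iff[OF that J] J by (simp add: tone_def)
  have Y: "?Y K J = (if K 2 = J 2 then U (K 1) (J 1) else 0) - a * (if K 2 = J 1 then U (K 1) (J 2) else 0)"
    if K: "K \<in> tidx n 2" for K
  proof -
    have "?Y K J = (\<Sum>c=1..n. (if c = J 1 then if K 2 = J 2 then U (K 1) (J 1) else 0 else 0)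
        - (if c = J 2 then if K 2 = J 1 then a * U (K 1) (J 2) else 0 else 0))"
      unfolding tmult_temb[OF K one_in_1_2]
      by (intro sum.cong refl)
        (auto simp: tmult_tR2 one t tidx_upd[OF K] right_diff_distrib Ua)
    also have "\<dots> = (if K 2 = J 2 then U (K 1) (J 1) else 0) - a * (if K 2 = J 1 then U (K 1) (J 2) else 0)"
      using tidx_range[OF J, of 1] tidx_range[OF J, of 2] by (simp add: sum_subtractf sum.delta)
    finally show ?thesis .
  qed
  have Z: "tmult n 2 (tR n 2 1 2 b) ?Y K J =
      (if K 2 = J 2 then U (K 1) (J 1) else 0) - a * (if K 2 = J 1 then U (K 1) (J 2) else 0)
      - b * ((if K 1 = J 2 then U (K 2) (J 1) else 0) - a * (if K 1 = J 1 then U (K 2) (J 2) else 0))"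
    if K: "K \<in> tidx n 2" for K
    using Y[OF K] Y[OF t[OF K]] by (simp add: tmult_tR2[OF K])
  have "tmult n 2 (temb n 2 2 V) (tmult n 2 (tR n 2 1 2 b) ?Y) I J =
      (\<Sum>c=1..n. (if c = J 2 then V (I 2) (J 2) * U (I 1) (J 1) else 0)
        - (if c = J 1 then a * (V (I 2) (J 1) * U (I 1) (J 2)) else 0)
        - (if I 1 = J 2 then b * (V (I 2) c * U c (J 1)) else 0)
        + (if I 1 = J 1 then a * (b * (V (I 2) c * U c (J 2))) else 0))"
    unfolding tmult_temb[OF I two_in_1_2]
    by (intro sum.cong refl)
      (auto simp: Z tidx_upd[OF I] right_diff_distrib Va Vb ab)
  also have "\<dots> = V (I 2) (J 2) * U (I 1) (J 1) - a * (V (I 2) (J 1) * U (I 1) (J 2))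
    - (if I 1 = J 2 then b * (\<Sum>c=1..n. V (I 2) c * U c (J 1)) else 0)
    + (if I 1 = J 1 then a * (b * (\<Sum>c=1..n. V (I 2) c * U c (J 2))) else 0)"
    using tidx_range[OF J, of 1] tidx_range[OF J, of 2]
    by (simp add: sum_subtractf sum.distrib sum.delta sum_distrib_left)
  finally show ?thesis
    by (simp add: tprod_def)
qed

section \<open>Complex scalars and scalar series in the reflection algebra\<close>

lemma free_scalar_commute: "free_scalar c * p = p * free_scalar c"
proof (induction p rule: update_induct)
  case (update f w d)
  then show ?case
    by (simp add: update_eq_add_single distrib_left distrib_right free_scalar_def mult_single mult.commute)
qed simp

lemma refl_scalar_add: "refl_scalar (c + d) = refl_scalar c + refl_scalar d"
  by transfer (simp add: free_scalar_def single_add ideal_gen.zero)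

lemma refl_scalar_mult: "refl_scalar (c * d) = refl_scalar c * refl_scalar d"
  by transfer (simp add: free_scalar_def mult_single ideal_gen.zero)

lemma refl_scalar_0 [simp]: "refl_scalar 0 = 0"
  by transfer (simp add: free_scalar_def ideal_gen.zero)

lemma refl_scalar_1 [simp]: "refl_scalar 1 = 1"
  by transfer (simp add: free_scalar_def ideal_gen.zero)

lemma refl_scalar_of_nat: "refl_scalar (of_nat k) = of_nat k"
  by (induction k) (simp_all add: refl_scalar_add)

lemma refl_scalar_sum: "refl_scalar (sum f A) = (\<Sum>x\<in>A. refl_scalar (f x))"
  by (induction A rule: infinite_finite_induct) (simp_all add: refl_scalar_add)

lemma refl_scalar_power: "refl_scalar (c ^ k) = refl_scalar c ^ k"
  by (induction k) (simp_all add: refl_scalar_mult)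

lemma central_refl_scalar: "central (refl_scalar c :: ('m::len0, 'l::len0) refl_alg)"
  unfolding central_def by (rule allI, transfer) (simp add: free_scalar_commute ideal_gen.zero)

text \<open>Scalar identities are proved over the complex numbers, where power series form an
  integral domain, and are transported along this ring homomorphism with central image.\<close>

definition refl_fps :: "complex fps \<Rightarrow> ('m::len0, 'l::len0) refl_alg fps" where
  "refl_fps f = Abs_fps (\<lambda>k. refl_scalar (fps_nth f k))"

lemma refl_fps_add: "refl_fps (f + g) = refl_fps f + refl_fps g"
  by (rule fps_ext) (simp add: refl_fps_def refl_scalar_add)

lemma refl_fps_mult: "refl_fps (f * g) = refl_fps f * refl_fps g"
  by (rule fps_ext) (simp add: refl_fps_def fps_mult_nth refl_scalar_sum refl_scalar_mult)

lemma refl_fps_1 [simp]: "refl_fps 1 = 1"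
  by (rule fps_ext) (simp add: refl_fps_def)

lemma refl_fps_X [simp]: "refl_fps fps_X = fps_X"
  by (rule fps_ext) (simp add: refl_fps_def fps_X_def)

lemma refl_fps_diff: "refl_fps (f - g) = refl_fps f - refl_fps g"
  by (simp add: eq_diff_eq flip: refl_fps_add)

lemma refl_fps_power: "refl_fps (f ^ k) = refl_fps f ^ k"
  by (induction k) (simp_all add: refl_fps_mult)

lemma central_refl_fps: "central (refl_fps f)"
  by (simp add: central_fps_iff refl_fps_def central_refl_scalar)

lemma refl_fps_inv_u_minus: "refl_fps (inv_u_minus c) = inv_u_minus (refl_scalar c)"
  by (rule fps_ext) (simp add: refl_fps_def inv_u_minus_def refl_scalar_power)

lemma inv_u_minus_of_nat: "inv_u_minus (of_nat c) = refl_fps (inv_u_minus (of_nat c))"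
  by (simp add: refl_fps_inv_u_minus refl_scalar_of_nat)

lemma refl_fps_const: "refl_fps (fps_const c) = fps_const (refl_scalar c)"
  by (rule fps_ext) (simp add: refl_fps_def)

lemma inv_2u_minus_eq_refl_fps:
  "inv_2u_minus c = refl_fps (fps_const (1/2) * inv_u_minus (c/2))"
  by (simp add: inv_2u_minus_def refl_fps_mult refl_fps_inv_u_minus refl_fps_const)

text \<open>A nonzero scalar series is an invertible series times a power of \<open>fps_X\<close>:
  the first factor is removed by its inverse, the second only shifts coefficients.\<close>

lemma refl_fps_mult_cancel:
  fixes x :: "('m::len0, 'l::len0) refl_alg fps"
  assumes "f \<noteq> 0" "refl_fps f * x = refl_fps f * y"
  shows "x = y"
proof -
  define u where "u = unit_factor f"
  have f: "f = u * fps_X ^ subdegree f"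
    unfolding u_def by (rule fps_unit_factor_decompose)
  have "inverse u * u = 1"
    using assms(1) by (intro inverse_mult_eq_1) (simp add: u_def)
  then have "inverse u * f = fps_X ^ subdegree f"
    by (subst f) (simp add: mult.assoc[symmetric])
  then have "fps_X ^ subdegree f * x = fps_X ^ subdegree f * y"
    using arg_cong[OF assms(2), of "\<lambda>z. refl_fps (inverse u) * z"]
    by (simp flip: mult.assoc refl_fps_mult) (simp add: refl_fps_power)
  then have "fps_nth (fps_X ^ subdegree f * x) (k + subdegree f) = fps_nth (fps_X ^ subdegree f * y) (k + subdegree f)" for k
    by simp
  then show ?thesis
    by (intro fps_ext) (simp add: fps_X_power_mult_nth)
qed

text \<open>The series 2 is a nonzero scalar. This is what turns \<open>x = - x\<close> into
  \<open>x = 0\<close> for alternating vectors.\<close>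

lemma refl_fps_double_eq_0:
  fixes x :: "('m::len0, 'l::len0) refl_alg fps"
  assumes "x + x = 0"
  shows "x = 0"
proof (rule refl_fps_mult_cancel[of 2])
  have "(2 :: complex fps) = 1 + 1" by simp
  then have "refl_fps 2 * x = x + x"
    by (simp only: refl_fps_add refl_fps_1 distrib_right mult_1)
  then show "refl_fps 2 * x = refl_fps 2 * 0" using assms by simp
qed simp

section \<open>Relations between expansions of simple fractions\<close>

lemma inv_u_minus_nonzero: "inv_u_minus c \<noteq> (0 :: 'a::ring_1 fps)"
proof
  assume "inv_u_minus c = 0"
  then have "fps_nth (inv_u_minus c) 1 = 0" by simp
  then show False by (simp add: inv_u_minus_def)
qed

text \<open>Both sides agree after multiplication by the two denominators, which cancel in the
  domain of complex series.\<close>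

lemma inv_u_minus_diff:
  "inv_u_minus (c + 1) - inv_u_minus c = inv_u_minus c * (inv_u_minus (c + 1) :: complex fps)"
proof -
  let ?X = "fps_X :: complex fps"
  let ?a = "1 - fps_const c * ?X" and ?b = "1 - fps_const (c + 1) * ?X"
  let ?g = "inv_u_minus c" and ?h = "inv_u_minus (c + 1)"
  have "?a * ?b * (?h - ?g) = ?a * (?b * ?h) - ?b * (?a * ?g)"
    by (simp add: algebra_simps)
  also have "\<dots> = (?a - ?b) * ?X"
    by (simp only: inv_u_minus_eq) (simp only: left_diff_distrib)
  also have "?a - ?b = ?X"
    by (simp add: algebra_simps flip: fps_const_add)
  also have "?X * ?X = (?a * ?g) * (?b * ?h)"
    by (simp only: inv_u_minus_eq)
  finally have "?a * ?b * (?h - ?g) = ?a * ?b * (?g * ?h)"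
    by (simp only: mult_ac)
  moreover have "fps_nth (?a * ?b) 0 \<noteq> 0" by simp
  ultimately show ?thesis
    using mult_left_cancel[of "?a * ?b"] by fastforce
qed

text \<open>Here \<open>w\<close> is \<open>1/(2u - c - d)\<close>, and \<open>2u - c - d\<close> is
  the sum of the denominators \<open>u - c\<close> and \<open>u - d\<close>.\<close>

lemma inv_2u_minus_rel:
  fixes c d :: complex
  defines "w \<equiv> fps_const (1/2) * inv_u_minus ((c + d)/2)"
  shows "(inv_u_minus c + inv_u_minus d) * w = inv_u_minus c * inv_u_minus d"
proof -
  let ?X = "fps_X :: complex fps"
  let ?a = "1 - fps_const c * ?X" and ?b = "1 - fps_const d * ?X"
  let ?g = "inv_u_minus c" and ?h = "inv_u_minus d" and ?k = "inv_u_minus ((c + d)/2)"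
  have "?a * ?b * ((?g + ?h) * w) = (?b * (?a * ?g) + ?a * (?b * ?h)) * w"
    by (simp add: algebra_simps)
  also have "\<dots> = (?a + ?b) * w * ?X"
    by (simp only: inv_u_minus_eq) (simp add: algebra_simps)
  also have "?a + ?b = 2 * (1 - fps_const ((c + d)/2) * ?X)"
    by (rule fps_ext) (simp add: numeral_fps_const fps_X_def field_simps)
  also have "\<dots> * w = (2 * fps_const (1/2)) * ((1 - fps_const ((c + d)/2) * ?X) * ?k)"
    unfolding w_def by (simp only: mult.assoc mult.left_commute)
  also have "\<dots> = ?X"
    by (simp add: inv_u_minus_eq numeral_fps_const)
  also have "?X * ?X = (?a * ?g) * (?b * ?h)"
    by (simp only: inv_u_minus_eq)
  finally have "?a * ?b * ((?g + ?h) * w) = ?a * ?b * (?g * ?h)"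
    by (simp only: mult_ac)
  moreover have "fps_nth (?a * ?b) 0 \<noteq> 0" by simp
  ultimately show ?thesis
    using mult_left_cancel[of "?a * ?b"] by fastforce
qed

section \<open>Clearing denominators with the monomials \<open>u^(-p) v^q\<close>\<close>

definition uv_monom :: "nat \<Rightarrow> nat \<Rightarrow> 'a::ring_1 fls fps" where
  "uv_monom p q = fps_const (fls_X_inv ^ q) * fps_X ^ p"

lemma central_uv_monom: "central (uv_monom p q)"
proof -
  have "central (fls_X_inv :: 'a::ring_1 fls)"
    unfolding central_def by (auto intro: fls_X_inv_times_comm)
  then show ?thesis
    unfolding uv_monom_def by (intro central_mult central_fps_const central_power central_fps_X)
qed

lemma uv_monom_mult: "uv_monom p q * uv_monom p' q' = (uv_monom (p + p') (q + q') :: 'a::ring_1 fls fps)"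
proof -
  have "fps_X ^ p * fps_const c = fps_const c * fps_X ^ p" for c :: "'a fls"
    by (rule centralD) (intro central_power central_fps_X)
  then show ?thesis
    unfolding uv_monom_def
    by (metis (no_types, lifting) fps_const_mult mult.assoc power_add)
qed

lemma uv_monom_inv_u_minus:
  "(1 - uv_monom 1 1) * inv_u_minus fls_X_inv = uv_monom 1 0"
    "(1 + uv_monom 1 1) * inv_u_minus (- fls_X_inv) = uv_monom 1 0"
  using inv_u_minus_eq[of fls_X_inv] inv_u_minus_eq[of "- fls_X_inv"]
  by (simp_all add: uv_monom_def flip: fps_const_neg)

text \<open>The coefficient of \<open>u^(-r) v^(-s)\<close> in \<open>v^(-2) F\<close>. The cleared
  equation has degree at most two in \<open>v\<close>, so after this shift natural numbers
  \<open>s\<close> suffice.\<close>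

definition coeff_uv :: "'a::ring_1 fls fps \<Rightarrow> nat \<Rightarrow> nat \<Rightarrow> 'a" where
  "coeff_uv F r s = fls_nth (fps_nth F r) (int s - 2)"

lemma coeff_uv_monom:
  assumes "q \<le> 2" and F: "\<And>r s. fls_nth (fps_nth F r) s = (if s < 0 then 0 else G r (nat s))"
  shows "coeff_uv (uv_monom p q * F) r s = (if p \<le> r \<and> 2 - q \<le> s then G (r - p) (s - (2 - q)) else 0)"
proof -
  have "coeff_uv (uv_monom p q * F) r s =
      (if r < p then 0 else fls_nth (fps_nth F (r - p)) (int s - 2 + int q))"
    by (simp add: coeff_uv_def uv_monom_def mult.assoc fps_X_power_mult_nth
        fls_X_inv_power_times_conv_shift)
  moreover have "nat (int s - 2 + int q) = s - (2 - q)" "(int s - 2 + int q < 0) = (s < 2 - q)"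
    using assms(1) by linarith+
  ultimately show ?thesis
    by (simp add: F not_less)
qed

lemma B_of_u_mult_nth:
  "fls_nth (fps_nth (B_of_u b i j * B_of_v b' k l) r) s = (if s < 0 then 0 else b i j r * b' k l (nat s))"
  "fls_nth (fps_nth (B_of_v b' k l * B_of_u b i j) r) s = (if s < 0 then 0 else b' k l (nat s) * b i j r)"
  by (simp_all add: B_of_u_def B_of_v_def)

text \<open>The factor is \<open>(1 - v/u)(1 + v/u)\<close>: it turns \<open>1/(u - v)\<close> into
  \<open>(1 + v/u)/u\<close>, \<open>1/(u + v)\<close> into \<open>(1 - v/u)/u\<close>, and their
  product into \<open>u^(-2)\<close>. All scalar coefficients become polynomials in \<open>v\<close>
  of degree at most two.\<close>

lemma refl_clear_denominators:
  fixes U V :: "nat \<Rightarrow> nat \<Rightarrow> 'a::ring_1 fls fps"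
  assumes I: "I \<in> tidx n 2" and J: "J \<in> tidx n 2"
  defines "a \<equiv> inv_u_minus fls_X_inv" and "b \<equiv> inv_u_minus (- fls_X_inv)"
    and "M \<equiv> uv_monom"
  shows "(1 - M 2 2) * tprod n 2 [tR n 2 1 2 a, temb n 2 1 U, tR n 2 1 2 b, temb n 2 2 V] I J =
      (M 0 0 - M 2 2) * (U (I 1) (J 1) * V (I 2) (J 2))
      - (M 1 0 + M 2 1) * (U (I 2) (J 1) * V (I 1) (J 2))
      - (if I 2 = J 1 then (M 1 0 - M 2 1) * (\<Sum>c=1..n. U (I 1) c * V c (J 2)) else 0)
      + (if I 1 = J 1 then M 2 0 * (\<Sum>c=1..n. U (I 2) c * V c (J 2)) else 0)" (is ?lhs)
    and "(1 - M 2 2) * tprod n 2 [temb n 2 2 V, tR n 2 1 2 b, temb n 2 1 U, tR n 2 1 2 a] I J =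
      (M 0 0 - M 2 2) * (V (I 2) (J 2) * U (I 1) (J 1))
      - (M 1 0 + M 2 1) * (V (I 2) (J 1) * U (I 1) (J 2))
      - (if I 1 = J 2 then (M 1 0 - M 2 1) * (\<Sum>c=1..n. V (I 2) c * U c (J 1)) else 0)
      + (if I 1 = J 1 then M 2 0 * (\<Sum>c=1..n. V (I 2) c * U c (J 2)) else 0)" (is ?rhs)
proof -
  have M0: "M 0 0 = 1" by (simp add: M_def uv_monom_def)
  have MM: "M p q * M p' q' = M (p + p') (q + q')" for p q p' q'
    unfolding M_def by (rule uv_monom_mult)
  have Mc: "central (M p q)" for p q
    unfolding M_def by (rule central_uv_monom)
  have split: "1 - M 2 2 = (1 + M 1 1) * (1 - M 1 1)"
    by (simp add: algebra_simps MM one_add_one)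
  have split': "1 - M 2 2 = (1 - M 1 1) * (1 + M 1 1)"
    by (simp add: algebra_simps MM one_add_one)
  have Ma: "(1 - M 1 1) * a = M 1 0" and Mb: "(1 + M 1 1) * b = M 1 0"
    unfolding M_def a_def b_def by (rule uv_monom_inv_u_minus)+
  have ca: "(1 - M 2 2) * a = M 1 0 + M 2 1"
    unfolding split mult.assoc Ma by (simp add: distrib_right MM one_add_one)
  have cb: "(1 - M 2 2) * b = M 1 0 - M 2 1"
    unfolding split' mult.assoc Mb by (simp add: left_diff_distrib MM one_add_one)
  have cab: "(1 - M 2 2) * (a * b) = M 2 0"
  proof -
    have "(1 - M 2 2) * (a * b) = (1 + M 1 1) * (((1 - M 1 1) * a) * b)"
      by (simp only: split mult.assoc)
    also have "\<dots> = M 1 0 * ((1 + M 1 1) * b)"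
      unfolding Ma by (rule central_left_commute[OF Mc])
    finally show ?thesis by (simp add: Mb MM one_add_one)
  qed
  have sa: "(1 - M 2 2) * (a * z) = (M 1 0 + M 2 1) * z"
    and sb: "(1 - M 2 2) * (b * z) = (M 1 0 - M 2 1) * z"
    and sab: "(M 1 0 + M 2 1) * (b * z) = M 2 0 * z" for z
    by (metis ca cb cab mult.assoc)+
  have X: "central (fls_X_inv :: 'a fls)"
    unfolding central_def by (auto intro: fls_X_inv_times_comm)
  have "central a" "central b"
    unfolding a_def b_def by (intro central_inv_u_minus central_uminus X)+
  then show ?lhs ?rhs
    unfolding M0 by (simp_all only: refl_lhs_entries[OF I J] refl_rhs_entries[OF I J]
        right_diff_distrib distrib_left if_distrib[of "(*) (1 - M 2 2)"] sa sb sab mult_zero_right)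
qed

section \<open>Passage to the quotient algebra and substitution for \<open>u\<close> and
  \<open>v\<close>\<close>

lemma two_sided_ideal_refl_rels: "two_sided_ideal (ideal_gen (refl_rels m l))"
  by standard (auto intro: ideal_gen.zero ideal_gen_add ideal_gen_mult_left ideal_gen_mult_right)

lemma abs_refl_alg_add: "abs_refl_alg (x + y) = abs_refl_alg x + abs_refl_alg y"
  by (simp add: plus_refl_alg.abs_eq)

lemma abs_refl_alg_diff: "abs_refl_alg (x - y) = abs_refl_alg x - abs_refl_alg y"
  by (simp add: minus_refl_alg.abs_eq)

lemma abs_refl_alg_mult: "abs_refl_alg (x * y) = abs_refl_alg x * abs_refl_alg y"
  by (simp add: times_refl_alg.abs_eq)

lemma abs_refl_alg_0: "abs_refl_alg 0 = 0"
  by (simp add: zero_refl_alg.abs_eq)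

lemma abs_refl_alg_eq_0:
  "x \<in> ideal_gen (refl_rels LENGTH('m) LENGTH('l)) \<Longrightarrow> abs_refl_alg x = (0 :: ('m::len0, 'l::len0) refl_alg)"
  by (simp add: zero_refl_alg_def refl_alg.abs_eq_iff)

lemma abs_free_b: "abs_refl_alg (free_b i j r) = refl_b i j r"
  by (simp add: refl_b.abs_eq)

text \<open>
  The value at \<open>u\<^sup>-\<^sup>1 = g\<close>, \<open>v\<^sup>-\<^sup>1 = h\<close> of \<open>v\<^sup>-\<^sup>2 F\<close>, for \<open>F\<close> of degree at most \<open>2\<close> in \<open>v\<close>.
\<close>

definition eval_uv ::
    "('m::len0, 'l::len0) refl_alg fps \<Rightarrow> ('m, 'l) refl_alg fps \<Rightarrow> bsym free_alg fls fps \<Rightarrow>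
     ('m, 'l) refl_alg fps" where
  "eval_uv g h F = eval2 g h (\<lambda>r s. abs_refl_alg (coeff_uv F r s))"

lemma eval_uv_add: "eval_uv g h (F + G) = eval_uv g h F + eval_uv g h G"
  by (simp add: eval_uv_def coeff_uv_def abs_refl_alg_add eval2_add)

lemma eval_uv_diff: "eval_uv g h (F - G) = eval_uv g h F - eval_uv g h G"
  by (simp add: eval_uv_def coeff_uv_def abs_refl_alg_diff eval2_diff)

lemma eval_uv_0: "eval_uv g h 0 = 0"
  by (simp add: eval_uv_def coeff_uv_def abs_refl_alg_0 eval2_0)

lemma eval_uv_sum: "eval_uv g h (\<Sum>c\<in>A. F c) = (\<Sum>c\<in>A. eval_uv g h (F c))"
  by (induction A rule: infinite_finite_induct) (simp_all add: eval_uv_add eval_uv_0)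

text \<open>The exponent \<open>2 - q\<close> combines the monomial's \<open>v^q\<close> with the
  factor \<open>v^(-2)\<close> built into \<open>eval_uv\<close>.\<close>

lemma eval_uv_monom:
  fixes g h :: "('m::len0, 'l::len0) refl_alg fps"
  assumes "fps_nth g 0 = 0" "fps_nth h 0 = 0" "central g" "central h" "q \<le> 2"
  shows "eval_uv g h (uv_monom p q * (B_of_u free_b i j * B_of_v free_b k l)) =
      g ^ p * h ^ (2 - q) * ((B_series i j oo g) * (B_series k l oo h))" (is ?uv)
    and "eval_uv g h (uv_monom p q * (B_of_v free_b k l * B_of_u free_b i j)) =
      g ^ p * h ^ (2 - q) * ((B_series k l oo h) * (B_series i j oo g))" (is ?vu)
proof -
  show ?uv
    unfolding eval_uv_def coeff_uv_monom[where G = "\<lambda>r s. free_b i j r * free_b k l s", OF assms(5) B_of_u_mult_nth(1)[of free_b i j free_b k l]] if_distrib[of abs_refl_alg]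
      abs_refl_alg_mult abs_refl_alg_0 abs_free_b
      eval2_shift[where G = "\<lambda>r s. refl_b i j r * refl_b k l s", OF assms(1-4)]
      eval2_mult[OF assms(1-3)] B_series_def ..
  show ?vu
    unfolding eval_uv_def coeff_uv_monom[where G = "\<lambda>r s. free_b k l s * free_b i j r", OF assms(5) B_of_u_mult_nth(2)[of free_b k l free_b i j]] if_distrib[of abs_refl_alg]
      abs_refl_alg_mult abs_refl_alg_0 abs_free_b
      eval2_shift[where G = "\<lambda>r s. refl_b k l s * refl_b i j r", OF assms(1-4)]
      eval2_mult_commuted[OF assms(1-4)] B_series_def ..
qed

text \<open>All coefficients of the difference of the two sides are defining relations. Series with
  coefficients in the ideal again form an ideal, so the clearing factor does no harm, and the
  quotient map kills the result.\<close>

lemma eval_uv_refl_eq: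
  assumes n: "n = LENGTH('m::len0) + LENGTH('l::len0)" and "I \<in> tidx n 2" "J \<in> tidx n 2"
  shows "eval_uv g h ((1 - uv_monom 2 2) * refl_eq_lhs n free_b I J) =
    (eval_uv g h ((1 - uv_monom 2 2) * refl_eq_rhs n free_b I J) :: ('m, 'l) refl_alg fps)"
proof -
  define K where "K = ideal_gen (refl_rels LENGTH('m) LENGTH('l))"
  interpret K: two_sided_ideal K
    unfolding K_def by (rule two_sided_ideal_refl_rels)
  interpret Kl: two_sided_ideal "{f. \<forall>r. fls_nth f r \<in> K}" by (rule K.fls_ideal)
  interpret Kpl: two_sided_ideal "{f. \<forall>r. fps_nth f r \<in> {f. \<forall>r. fls_nth f r \<in> K}}"
    by (rule Kl.fps_ideal)
  let ?D = "refl_eq_lhs n free_b I J - refl_eq_rhs n free_b I J"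
  have "fls_nth (fps_nth ?D r) s \<in> K" for r s
  proof -
    have "fls_nth (fps_nth ?D r) s \<in> refl_rels LENGTH('m) LENGTH('l)"
      unfolding refl_rels_def Let_def n[symmetric] using assms(2,3) by blast
    then show ?thesis
      using ideal_gen.step[OF ideal_gen.zero, of _ _ 1 1] by (simp add: K_def)
  qed
  then have "(1 - uv_monom 2 2) * ?D \<in> {f. \<forall>r. fps_nth f r \<in> {f. \<forall>r. fls_nth f r \<in> K}}"
    by (intro Kpl.mult_left_mem) simp
  then have "coeff_uv ((1 - uv_monom 2 2) * ?D) r s \<in> K" for r s
    by (simp add: coeff_uv_def)
  then have "eval_uv g h ((1 - uv_monom 2 2) * ?D) = (0 :: ('m, 'l) refl_alg fps)"
    unfolding eval_uv_def K_def by (simp add: abs_refl_alg_eq_0 eval2_0)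
  then show ?thesis
    by (simp add: right_diff_distrib eval_uv_diff)
qed

definition B_shift :: "nat \<Rightarrow> nat \<Rightarrow> nat \<Rightarrow> ('m::len0, 'l::len0) refl_alg fps" where
  "B_shift c i j = B_series i j oo inv_u_minus (of_nat c)"

text \<open>The reflection equation for \<open>u - c\<close>, \<open>v = u - c - 1\<close>, where \<open>R(u - v) = 1 - P\<close>.\<close>

lemma reflection_shift:
  fixes c :: nat
  assumes n: "n = LENGTH('m::len0) + LENGTH('l::len0)"
    and ij: "i1 \<in> {1..n}" "i2 \<in> {1..n}" "j1 \<in> {1..n}" "j2 \<in> {1..n}"
  defines "B \<equiv> B_shift c :: nat \<Rightarrow> nat \<Rightarrow> ('m, 'l) refl_alg fps"
    and "B' \<equiv> B_shift (Suc c) :: nat \<Rightarrow> nat \<Rightarrow> ('m, 'l) refl_alg fps"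
    and "w \<equiv> inv_2u_minus (of_nat (2 * c + 1)) :: ('m, 'l) refl_alg fps"
  shows "B i1 j1 * B' i2 j2 - B i2 j1 * B' i1 j2
      - (if i2 = j1 then w * (\<Sum>a=1..n. B i1 a * B' a j2) else 0)
      + (if i1 = j1 then w * (\<Sum>a=1..n. B i2 a * B' a j2) else 0) =
    B' i2 j2 * B i1 j1 - B' i2 j1 * B i1 j2
      - (if i1 = j2 then w * (\<Sum>a=1..n. B' i2 a * B a j1) else 0)
      + (if i1 = j1 then w * (\<Sum>a=1..n. B' i2 a * B a j2) else 0)"
proof -
  define g0 h0 w0 :: "complex fps" where "g0 = inv_u_minus (of_nat c)"
    and "h0 = inv_u_minus (of_nat c + 1)"
    and "w0 = fps_const (1/2) * inv_u_minus ((of_nat c + (of_nat c + 1))/2)"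
  define g h :: "('m, 'l) refl_alg fps" where "g = refl_fps g0" and "h = refl_fps h0"
  \<comment> \<open>The evaluated coefficients \<open>h^2 - g^2\<close>,
    \<open>g h^2 + g^2 h\<close>, \<open>g h^2 - g^2 h\<close>, \<open>g^2 h^2\<close> will turn out
    to be \<open>d0\<close> times 1, 1, \<open>w0\<close>, \<open>w0\<close>; this common factor is
    cancelled at the end.\<close>
  define d0 where "d0 = g0 * h0 * (g0 + h0)"
  have diff: "h0 - g0 = g0 * h0"
    unfolding g0_def h0_def by (rule inv_u_minus_diff)
  have wgh: "(g0 + h0) * w0 = g0 * h0"
    unfolding g0_def h0_def w0_def by (rule inv_2u_minus_rel)
  have w: "w = refl_fps w0"
    unfolding w_def w0_def inv_2u_minus_eq_refl_fps by simp
  have B: "B i j = B_series i j oo g" and B': "B' i j = B_series i j oo h" for i j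
    unfolding B_def B'_def B_shift_def g_def h_def g0_def h0_def inv_u_minus_of_nat
    by (simp_all add: add.commute)
  have gh: "fps_nth g 0 = 0" "fps_nth h 0 = 0" "central g" "central h"
    unfolding g_def h_def g0_def h0_def
    by (simp_all add: central_refl_fps) (simp_all add: refl_fps_def inv_u_minus_def)
  have d00: "d0 \<noteq> 0"
  proof -
    have "fps_nth (g0 + h0) 1 \<noteq> 0" by (simp add: g0_def h0_def inv_u_minus_def)
    then have "g0 + h0 \<noteq> 0" by (metis fps_zero_nth)
    then show ?thesis
      by (simp add: d0_def g0_def h0_def inv_u_minus_nonzero)
  qed
  have c1: "h0 ^ 2 - g0 ^ 2 = d0"
  proof -
    have "h0 ^ 2 - g0 ^ 2 = (h0 - g0) * (g0 + h0)" by (simp add: algebra_simps power2_eq_square)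
    then show ?thesis by (simp only: diff d0_def)
  qed
  have c2: "g0 * h0 ^ 2 + g0 ^ 2 * h0 = d0"
    by (simp add: d0_def algebra_simps power2_eq_square)
  have c4: "g0 ^ 2 * h0 ^ 2 = d0 * w0"
  proof -
    have "d0 * w0 = g0 * h0 * ((g0 + h0) * w0)" by (simp only: d0_def mult.assoc)
    also have "\<dots> = g0 ^ 2 * h0 ^ 2" unfolding wgh by (simp only: power2_eq_square mult_ac)
    finally show ?thesis by (rule sym)
  qed
  have c3: "g0 * h0 ^ 2 - g0 ^ 2 * h0 = d0 * w0"
  proof -
    have "g0 * h0 ^ 2 - g0 ^ 2 * h0 = g0 * h0 * (h0 - g0)"
      by (simp add: algebra_simps power2_eq_square)
    then show ?thesis by (simp only: c4[symmetric] diff power2_eq_square mult_ac)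
  qed
  have r1: "h ^ 2 - g ^ 2 = refl_fps d0" and r2: "g * h ^ 2 + g ^ 2 * h = refl_fps d0"
    and r3: "g * h ^ 2 - g ^ 2 * h = refl_fps d0 * w" and r4: "g ^ 2 * h ^ 2 = refl_fps d0 * w"
    unfolding g_def h_def w
    by (simp_all only: c1 c2 c3 c4 flip: refl_fps_power refl_fps_mult refl_fps_diff refl_fps_add)
  define I J :: "nat \<Rightarrow> nat" where "I = (\<lambda>x\<in>{1..2}. if x = 1 then i1 else i2)"
    and "J = (\<lambda>x\<in>{1..2}. if x = 1 then j1 else j2)"
  have IJ: "I \<in> tidx n 2" "J \<in> tidx n 2"
    using ij by (auto simp: I_def J_def tidx_def)
  have IJv: "I 1 = i1" "I 2 = i2" "J 1 = j1" "J 2 = j2"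
    by (simp_all add: I_def J_def)
  let ?U = "B_of_u free_b" and ?V = "B_of_v free_b"
  note ev = eval_uv_monom[OF gh, folded B B']
  have b2: "(0::nat) \<le> 2" "(1::nat) \<le> 2" "(2::nat) \<le> 2" by simp_all
  have e: "eval_uv g h (uv_monom p q * (\<Sum>a=1..n. ?U i a * ?V a j)) = g ^ p * h ^ (2 - q) * (\<Sum>a=1..n. B i a * B' a j)"
    "eval_uv g h (uv_monom p q * (\<Sum>a=1..n. ?V i a * ?U a j)) = g ^ p * h ^ (2 - q) * (\<Sum>a=1..n. B' i a * B a j)"
    if "q \<le> 2" for p q i j
    by (simp_all add: sum_distrib_left eval_uv_sum ev[OF that])
  have n2: "(2 - 0 :: nat) = 2" "(2 - 1 :: nat) = 1" "(2 - 2 :: nat) = 0" by simp_all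
  note simps = distrib_right left_diff_distrib eval_uv_add eval_uv_diff if_distrib[of "eval_uv g h"]
    eval_uv_0 ev[OF b2(1)] ev[OF b2(2)] ev[OF b2(3)] e[OF b2(1)] e[OF b2(2)] e[OF b2(3)] n2
    power_0 power_one_right mult_1 mult_1_right
  let ?L = "B i1 j1 * B' i2 j2 - B i2 j1 * B' i1 j2
      - (if i2 = j1 then w * (\<Sum>a=1..n. B i1 a * B' a j2) else 0)
      + (if i1 = j1 then w * (\<Sum>a=1..n. B i2 a * B' a j2) else 0)"
  let ?R = "B' i2 j2 * B i1 j1 - B' i2 j1 * B i1 j2
      - (if i1 = j2 then w * (\<Sum>a=1..n. B' i2 a * B a j1) else 0)
      + (if i1 = j1 then w * (\<Sum>a=1..n. B' i2 a * B a j2) else 0)"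
  have "eval_uv g h ((1 - uv_monom 2 2) * refl_eq_lhs n free_b I J) =
      (h ^ 2 - g ^ 2) * (B i1 j1 * B' i2 j2) - (g * h ^ 2 + g ^ 2 * h) * (B i2 j1 * B' i1 j2)
      - (if i2 = j1 then (g * h ^ 2 - g ^ 2 * h) * (\<Sum>a=1..n. B i1 a * B' a j2) else 0)
      + (if i1 = j1 then g ^ 2 * h ^ 2 * (\<Sum>a=1..n. B i2 a * B' a j2) else 0)"
    unfolding refl_eq_lhs_def refl_clear_denominators(1)[OF IJ] IJv by (simp only: simps)
  also have "\<dots> = refl_fps d0 * ?L"
    unfolding r1 r2 r3 r4 by (simp add: algebra_simps)
  finally have L: "eval_uv g h ((1 - uv_monom 2 2) * refl_eq_lhs n free_b I J) = refl_fps d0 * ?L" .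
  have "eval_uv g h ((1 - uv_monom 2 2) * refl_eq_rhs n free_b I J) =
      (h ^ 2 - g ^ 2) * (B' i2 j2 * B i1 j1) - (g * h ^ 2 + g ^ 2 * h) * (B' i2 j1 * B i1 j2)
      - (if i1 = j2 then (g * h ^ 2 - g ^ 2 * h) * (\<Sum>a=1..n. B' i2 a * B a j1) else 0)
      + (if i1 = j1 then g ^ 2 * h ^ 2 * (\<Sum>a=1..n. B' i2 a * B a j2) else 0)"
    unfolding refl_eq_rhs_def refl_clear_denominators(2)[OF IJ] IJv by (simp only: simps)
  also have "\<dots> = refl_fps d0 * ?R"
    unfolding r1 r2 r3 r4 by (simp add: algebra_simps)
  finally have R: "eval_uv g h ((1 - uv_monom 2 2) * refl_eq_rhs n free_b I J) = refl_fps d0 * ?R" .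
  have "refl_fps d0 * ?L = refl_fps d0 * ?R"
    using eval_uv_refl_eq[OF n IJ, of g h] by (simp only: L R)
  then show ?thesis
    by (rule refl_fps_mult_cancel[OF d00])
qed

section \<open>Operators acting on row vectors\<close>

text \<open>
  A row vector is a function \<open>f\<close> on multi-indices. Operators act on row vectors from the right;
  on the rows of a matrix \<open>Z\<close> this gives the product \<open>Z X\<close>.
\<close>

definition row_temb :: "nat \<Rightarrow> nat \<Rightarrow> (nat \<Rightarrow> nat \<Rightarrow> 'a::ring_1) \<Rightarrow> ((nat \<Rightarrow> nat) \<Rightarrow> 'a) \<Rightarrow> (nat \<Rightarrow> nat) \<Rightarrow> 'a" where
  "row_temb n s X f = (\<lambda>J. \<Sum>a=1..n. f (J(s := a)) * X a (J s))"

definition row_R :: "nat \<Rightarrow> nat \<Rightarrow> 'a::ring_1 \<Rightarrow> ((nat \<Rightarrow> nat) \<Rightarrow> 'a) \<Rightarrow> (nat \<Rightarrow> nat) \<Rightarrow> 'a" where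
  "row_R i j w f = (\<lambda>J. f J - w * f (J \<circ> Transposition.transpose i j))"

definition row_Pi :: "nat \<Rightarrow> nat \<Rightarrow> 'a::ring_1 \<Rightarrow> ((nat \<Rightarrow> nat) \<Rightarrow> 'a) \<Rightarrow> (nat \<Rightarrow> nat) \<Rightarrow> 'a" where
  "row_Pi n k w f = (\<lambda>J. f J - w * (\<Sum>i=k+1..n. f (J \<circ> Transposition.transpose k i)))"

text \<open>The comparison of the two brackets takes \<open>S = UNIV\<close>; the reflection
  equation yields alternation on \<open>tidx n n\<close> only.\<close>

definition alternates_on :: "(nat \<Rightarrow> nat) set \<Rightarrow> nat \<Rightarrow> nat \<Rightarrow> ((nat \<Rightarrow> nat) \<Rightarrow> 'a::ring_1) \<Rightarrow> bool" where
  "alternates_on S i j f \<longleftrightarrow> (\<forall>J\<in>S. f (J \<circ> Transposition.transpose i j) = - f J)"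

section \<open>Transpositions of positions, and operators that preserve alternation\<close>

lemma comp_transpose_transpose [simp]:
  "J \<circ> Transposition.transpose i j \<circ> Transposition.transpose i j = J"
  by (simp add: comp_assoc)

lemma comp_transpose_braid:
  assumes "i \<noteq> j" "k \<noteq> i" "k \<noteq> j"
  shows "J \<circ> Transposition.transpose k j \<circ> Transposition.transpose k i =
    J \<circ> Transposition.transpose k i \<circ> Transposition.transpose i j"
  using assms by (auto simp: fun_eq_iff Transposition.transpose_def)

lemma comp_transpose_conj:
  assumes "i \<noteq> j" "k \<noteq> i" "k \<noteq> j"
  shows "J \<circ> Transposition.transpose k j =
    J \<circ> Transposition.transpose i j \<circ> Transposition.transpose k i \<circ> Transposition.transpose i j"
  using assms by (auto simp: fun_eq_iff Transposition.transpose_def)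

lemma comp_transpose_commute:
  assumes "k \<notin> {i, j}" "l \<notin> {i, j}"
  shows "J \<circ> Transposition.transpose i j \<circ> Transposition.transpose k l =
    J \<circ> Transposition.transpose k l \<circ> Transposition.transpose i j"
  using assms by (auto simp: fun_eq_iff Transposition.transpose_def)

lemma upd_comp_transpose:
  assumes "s \<notin> {i, j}"
  shows "(J \<circ> Transposition.transpose i j)(s := a) = J(s := a) \<circ> Transposition.transpose i j"
  using assms by (auto simp: fun_eq_iff Transposition.transpose_def)

lemma comp_transpose_outside:
  "s \<notin> {i, j} \<Longrightarrow> (J \<circ> Transposition.transpose i j) s = J s"
  by simp

lemma tidx_transpose:
  "J \<in> tidx n k \<Longrightarrow> i \<in> {1..k} \<Longrightarrow> j \<in> {1..k} \<Longrightarrow> J \<circ> Transposition.transpose i j \<in> tidx n k"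
  by (intro tidx_comp permutes_swap_id)

lemma row_R_commute_temb:
  assumes "s \<notin> {i, j}" "central w"
  shows "row_R i j w (row_temb n s X f) = row_temb n s X (row_R i j w f)"
proof
  fix J
  show "row_R i j w (row_temb n s X f) J = row_temb n s X (row_R i j w f) J"
    unfolding row_R_def row_temb_def upd_comp_transpose[OF assms(1)] comp_transpose_outside[OF assms(1)]
    by (simp add: left_diff_distrib sum_subtractf sum_distrib_left mult.assoc)
qed

lemma row_R_commute:
  assumes "k \<notin> {i, j}" "l \<notin> {i, j}" "central v" "central w"
  shows "row_R i j v (row_R k l w f) = row_R k l w (row_R i j v f)"
proof
  fix J
  have "v * (w * x) = w * (v * x)" for x
    using assms(3) by (metis central_left_commute)
  then show "row_R i j v (row_R k l w f) J = row_R k l w (row_R i j v f) J"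
    unfolding row_R_def comp_transpose_commute[OF assms(1,2)] by (simp add: algebra_simps)
qed

lemma alternates_on_row_temb:
  assumes "alternates_on S i j f" "s \<notin> {i, j}" "\<And>J a. J \<in> S \<Longrightarrow> a \<in> {1..n} \<Longrightarrow> J(s := a) \<in> S"
  shows "alternates_on S i j (row_temb n s X f)"
  unfolding alternates_on_def
proof
  fix J assume "J \<in> S"
  then have "f (J(s := a) \<circ> Transposition.transpose i j) = - f (J(s := a))" if "a \<in> {1..n}" for a
    using assms(1,3) that by (auto simp: alternates_on_def)
  then show "row_temb n s X f (J \<circ> Transposition.transpose i j) = - row_temb n s X f J"
    unfolding row_temb_def upd_comp_transpose[OF assms(2)] comp_transpose_outside[OF assms(2)]
    by (simp add: sum_negf)
qed

lemma alternates_on_row_R: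
  assumes "alternates_on S i j f" "k \<notin> {i, j}" "l \<notin> {i, j}"
    and "\<And>J. J \<in> S \<Longrightarrow> J \<circ> Transposition.transpose k l \<in> S"
  shows "alternates_on S i j (row_R k l w f)"
  using assms unfolding alternates_on_def row_R_def comp_transpose_commute[OF assms(2,3)]
  by simp

text \<open>
  The Yang--Baxter equation for \<open>R\<^sub>i\<^sub>j(1) = 1 - P\<^sub>i\<^sub>j\<close>: with \<open>1/w - 1/w' = 1\<close>, the product
  \<open>R\<^sub>k\<^sub>i(1/w) R\<^sub>k\<^sub>j(1/w')\<close> preserves the vectors that alternate in \<open>i\<close>, \<open>j\<close>.
\<close>

lemma alternates_on_row_R_pair:
  assumes f: "alternates_on S i j f" and ijk: "i \<noteq> j" "k \<noteq> i" "k \<noteq> j"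
    and w: "w' - w = w * w'" "central w"
    and S: "\<And>J. J \<in> S \<Longrightarrow> J \<circ> Transposition.transpose i j \<in> S"
      "\<And>J. J \<in> S \<Longrightarrow> J \<circ> Transposition.transpose k i \<in> S"
  shows "alternates_on S i j (row_R k j w' (row_R k i w f))"
proof -
  let ?s = "Transposition.transpose i j" and ?p = "Transposition.transpose k i"
  let ?g = "row_R k j w' (row_R k i w f)"
  have f': "f (J \<circ> ?s) = - f J" if "J \<in> S" for J
    using f that by (simp add: alternates_on_def)
  \<comment> \<open>Alternation of \<open>f\<close> rewrites both terms with
    \<open>Transposition.transpose k j\<close> through \<open>?p\<close>; the resulting formula
    visibly changes sign under \<open>?s\<close>.\<close>
  have g: "?g J = f J + w' * (f (J \<circ> ?s \<circ> ?p) - f (J \<circ> ?p))" if J: "J \<in> S" for J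
  proof -
    have 1: "f (J \<circ> Transposition.transpose k j) = - f (J \<circ> ?s \<circ> ?p)"
      unfolding comp_transpose_conj[OF ijk, of J] by (intro f' S J)
    have 2: "f (J \<circ> Transposition.transpose k j \<circ> ?p) = - f (J \<circ> ?p)"
      unfolding comp_transpose_braid[OF ijk, of J] by (intro f' S J)
    \<comment> \<open>The relation between \<open>w\<close> and \<open>w'\<close> merges the linear
      and the quadratic term in \<open>f (J \<circ> ?p)\<close>.\<close>
    have "w' = w + w' * w"
      using w by (metis centralD diff_eq_eq add.commute)
    then have "w' * f (J \<circ> ?p) = w * f (J \<circ> ?p) + w' * (w * f (J \<circ> ?p))"
      by (metis distrib_right mult.assoc)
    then show ?thesis
      by (simp add: row_R_def 1 2 algebra_simps)
  qed
  show ?thesis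
    unfolding alternates_on_def using g[OF S(1)] by (simp add: g f' algebra_simps)
qed

section \<open>Telescoping of \<open>R\<close>-factors on alternating row vectors\<close>

lemma row_R_sym: "row_R i j w f = row_R j i w f"
  by (simp add: row_R_def transpose_commute)

text \<open>The quadratic term \<open>b * (a * s)\<close> completes \<open>a * s\<close> to
  \<open>b * s\<close>.\<close>

lemma telescope_step:
  fixes a b :: "'a::ring_1"
  assumes "b = a + b * a"
  shows "y - a * s - b * (x + a * s) = y - b * (s + x)"
proof -
  have "b * s = a * s + b * (a * s)"
    using assms by (metis distrib_right mult.assoc)
  then show ?thesis
    by (simp only: distrib_left diff_add_eq_diff_diff_swap) (simp add: algebra_simps)
qed

text \<open>Induction on the last factor. A product of two transpositions through \<open>k\<close>
  is braided into one such transposition and the exchange of \<open>i\<close> with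
  \<open>Suc m\<close>, under which \<open>f\<close> changes sign; so the old sum reappears negated
  and \<open>telescope_step\<close> absorbs it.\<close>

lemma fold_row_R_eq_row_Pi:
  fixes W :: "nat \<Rightarrow> 'a::ring_1"
  assumes f: "\<And>i j. k < i \<Longrightarrow> i < j \<Longrightarrow> j \<le> n \<Longrightarrow> alternates_on UNIV i j f"
    and W: "\<And>j. W (Suc j) - W j = W j * W (Suc j)" "\<And>j. central (W j)"
    and "k \<le> m" "m \<le> n"
  shows "fold (\<lambda>j. row_R k j (W j)) [k+1..<m+1] f = row_Pi m k (W m) f"
  using \<open>k \<le> m\<close> \<open>m \<le> n\<close>
proof (induction m rule: dec_induct)
  case base
  then show ?case by (simp add: row_Pi_def)
next
  case (step m)
  show ?case
  proof
    fix J
    let ?S = "\<Sum>i=k+1..m. f (J \<circ> Transposition.transpose k i)"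
    have "(\<Sum>i=k+1..m. f (J \<circ> Transposition.transpose k (Suc m) \<circ> Transposition.transpose k i)) =
        (\<Sum>i=k+1..m. - f (J \<circ> Transposition.transpose k i))"
    proof (intro sum.cong refl)
      fix i assume i: "i \<in> {k+1..m}"
      then have "J \<circ> Transposition.transpose k (Suc m) \<circ> Transposition.transpose k i =
          J \<circ> Transposition.transpose k i \<circ> Transposition.transpose i (Suc m)"
        by (intro comp_transpose_braid) auto
      moreover have "alternates_on UNIV i (Suc m) f"
        using i step.prems by (intro f) auto
      ultimately show "f (J \<circ> Transposition.transpose k (Suc m) \<circ> Transposition.transpose k i) =
          - f (J \<circ> Transposition.transpose k i)"
        by (simp add: alternates_on_def)
    qed
    also have "\<dots> = - ?S" by (simp add: sum_negf)
    finally have S: "(\<Sum>i=k+1..m. f (J \<circ> Transposition.transpose k (Suc m) \<circ> Transposition.transpose k i)) = - ?S" .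
    have W': "W (Suc m) = W m + W (Suc m) * W m"
      using W by (metis centralD diff_eq_eq add.commute)
    have "[k+1..<Suc m+1] = [k+1..<m+1] @ [Suc m]" using step.hyps by simp
    then have "fold (\<lambda>j. row_R k j (W j)) [k+1..<Suc m+1] f J = row_R k (Suc m) (W (Suc m)) (row_Pi m k (W m) f) J"
      using step by (simp flip: Suc_eq_plus1)
    also have "\<dots> = f J - W m * ?S - W (Suc m) * (f (J \<circ> Transposition.transpose k (Suc m)) + W m * ?S)"
      by (simp add: row_R_def row_Pi_def S[simplified])
    also have "\<dots> = f J - W (Suc m) * (?S + f (J \<circ> Transposition.transpose k (Suc m)))"
      by (rule telescope_step[OF W'])
    also have "\<dots> = row_Pi (Suc m) k (W (Suc m)) f J"
      using step.hyps by (simp add: row_Pi_def)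
    finally show "fold (\<lambda>j. row_R k j (W j)) [k+1..<Suc m+1] f J = row_Pi (Suc m) k (W (Suc m)) f J" .
  qed
qed

text \<open>Conjugation by the exchange of \<open>i\<close> and \<open>j\<close>, both beyond
  \<open>k\<close>, only permutes the summands of \<open>row_Pi\<close>.\<close>

lemma alternates_on_row_Pi:
  assumes f: "alternates_on UNIV i j f" and ij: "k < i" "i \<le> n" "k < j" "j \<le> n" "i \<noteq> j"
  shows "alternates_on UNIV i j (row_Pi n k w f)"
  unfolding alternates_on_def
proof
  fix J
  let ?s = "Transposition.transpose i j"
  have f': "f (J \<circ> ?s) = - f J" for J
    using f by (simp add: alternates_on_def)
  have "(\<Sum>l=k+1..n. f (J \<circ> ?s \<circ> Transposition.transpose k l)) =
      (\<Sum>l=k+1..n. - f (J \<circ> Transposition.transpose k l))"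
  proof (rule sum.reindex_bij_witness[of _ ?s ?s])
    fix l assume l: "l \<in> {k+1..n}"
    have "J \<circ> ?s \<circ> Transposition.transpose k l \<circ> ?s = J \<circ> Transposition.transpose k (?s l)"
      using ij l by (auto simp: fun_eq_iff Transposition.transpose_def)
    then show "- f (J \<circ> Transposition.transpose k (?s l)) = f (J \<circ> ?s \<circ> Transposition.transpose k l)"
      using f'[of "J \<circ> ?s \<circ> Transposition.transpose k l"] by simp
  qed (use ij in \<open>auto simp: Transposition.transpose_def\<close>)
  then show "row_Pi n k w f (J \<circ> ?s) = - row_Pi n k w f J"
    by (simp add: row_Pi_def f' sum_negf)
qed

text \<open>Serves to sort two consecutive runs of \<open>R\<close>-factors into pairs with a common
  index; \<open>h x\<close> moves back through the \<open>g y\<close> with later \<open>y\<close>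
  until it meets \<open>g x\<close>.\<close>

lemma fold_fold_interleave:
  assumes "distinct xs"
    and "\<And>x y z. x \<in> set xs \<Longrightarrow> y \<in> set xs \<Longrightarrow> x \<noteq> y \<Longrightarrow> h x (g y z) = g y (h x z)"
  shows "fold h xs (fold g xs z) = fold (\<lambda>x. h x \<circ> g x) xs z"
  using assms
proof (induction xs arbitrary: z)
  case (Cons x xs)
  have "h x (fold g xs y) = fold g xs (h x y)" for y
    using Cons.prems by (intro fold_commute_apply) (auto simp: fun_eq_iff)
  then show ?case using Cons by simp
qed simp

section \<open>Translation of matrix products into actions on row vectors\<close>

definition row_act :: "nat \<Rightarrow> 'a::ring_1 tmat \<Rightarrow> ((nat \<Rightarrow> nat) \<Rightarrow> 'a) \<Rightarrow> (nat \<Rightarrow> nat) \<Rightarrow> 'a" where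
  "row_act n X f = (\<lambda>J. \<Sum>K\<in>tidx n n. f K * X K J)"

text \<open>The values of row vectors outside \<^term>\<open>tidx n n\<close> are junk, hence the restricted equality.\<close>

definition acts_as :: "nat \<Rightarrow> 'a::ring_1 tmat \<Rightarrow> (((nat \<Rightarrow> nat) \<Rightarrow> 'a) \<Rightarrow> (nat \<Rightarrow> nat) \<Rightarrow> 'a) \<Rightarrow> bool" where
  "acts_as n X p \<longleftrightarrow>
    (\<forall>f g. (\<forall>J\<in>tidx n n. f J = g J) \<longrightarrow> (\<forall>J\<in>tidx n n. row_act n X f J = p g J))"

lemma tmult_assoc:
  fixes X Y Z :: "'a::ring_1 tmat"
  shows "tmult n k (tmult n k X Y) Z = tmult n k X (tmult n k Y Z)"
  unfolding tmult_def
  by (intro ext) (simp add: sum_distrib_left sum_distrib_right mult.assoc, rule sum.swap)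

lemma tmult_tprod_acts_as:
  assumes "list_all2 (acts_as n) Xs ps" "J \<in> tidx n n"
  shows "tmult n n Z (tprod n n Xs) I J = fold (\<lambda>p. p) ps (Z I) J"
proof -
  \<comment> \<open>Generalised to every \<open>f\<close> that agrees with \<open>Z I\<close> on
    multi-indices, which is all that survives the first operator.\<close>
  have "tmult n n Z (tprod n n Xs) I J = fold (\<lambda>p. p) ps f J"
    if "\<forall>J\<in>tidx n n. Z I J = f J" for f
    using assms(1) that
  proof (induction arbitrary: Z f rule: list_all2_induct)
    case Nil
    then show ?case using assms(2) by (simp add: tprod_def tmult_tone_right)
  next
    case (Cons X Xs p ps)
    have "\<forall>J\<in>tidx n n. tmult n n Z X I J = p f J"
      using Cons by (auto simp: acts_as_def row_act_def tmult_def)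
    then show ?case
      using Cons.IH[of "tmult n n Z X" "p f"] by (simp add: tprod_def tmult_assoc)
  qed
  then show ?thesis by simp
qed

text \<open>Every product ends in \<open>tone\<close>, whose column \<open>J\<close> is zero
  here.\<close>

lemma tmult_tprod_outside:
  assumes "J \<notin> tidx n k"
  shows "tmult n k Z (tprod n k Xs) I J = 0"
proof -
  have "tprod n k Xs K J = 0" for K
    by (induction Xs arbitrary: K) (use assms in \<open>auto simp: tprod_def tone_def tmult_def\<close>)
  then show ?thesis by (simp add: tmult_def)
qed

lemma acts_as_temb:
  assumes "s \<in> {1..n}"
  shows "acts_as n (temb n n s X) (row_temb n s X)"
  unfolding acts_as_def
proof (intro allI impI ballI)
  fix f g :: "(nat \<Rightarrow> nat) \<Rightarrow> 'a" and J
  assume fg: "\<forall>J\<in>tidx n n. f J = g J" and J: "J \<in> tidx n n"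
  have "temb n n s X K J = (if \<forall>t\<in>{1..n} - {s}. J t = K t then X (K s) (J s) else 0)"
    if "K \<in> tidx n n" for K
    using that J unfolding temb_def by (auto 0 3 dest: bspec)
  then have "row_act n (temb n n s X) f J =
      (\<Sum>K | K \<in> tidx n n \<and> (\<forall>t\<in>{1..n} - {s}. J t = K t). f K * X (K s) (J s))"
    unfolding row_act_def by (intro sum.mono_neutral_cong_right) auto
  also have "\<dots> = row_temb n s X g J"
    unfolding sum_temb_index[OF J assms] row_temb_def
    using fg tidx_upd[OF J assms] by (intro sum.cong) auto
  finally show "row_act n (temb n n s X) f J = row_temb n s X g J" .
qed

lemma sum_mult_tP:
  fixes f :: "(nat \<Rightarrow> nat) \<Rightarrow> 'a::ring_1"
  assumes "J \<in> tidx n n" "i \<in> {1..n}" "j \<in> {1..n}"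
  shows "(\<Sum>K\<in>tidx n n. f K * tP n n i j K J) = f (J \<circ> Transposition.transpose i j)"
proof -
  have "(\<Sum>K\<in>tidx n n. f K * tP n n i j K J) =
      (\<Sum>K\<in>tidx n n. if K = J \<circ> Transposition.transpose i j then f K else 0)"
    unfolding tP_def tperm_def using assms(1) by (intro sum.cong) auto
  then show ?thesis
    using tidx_transpose[OF assms] by (simp add: sum.delta)
qed

lemma sum_mult_tone:
  fixes f :: "(nat \<Rightarrow> nat) \<Rightarrow> 'a::ring_1"
  assumes "J \<in> tidx n n"
  shows "(\<Sum>K\<in>tidx n n. f K * tone n n K J) = f J"
proof -
  have "(\<Sum>K\<in>tidx n n. f K * tone n n K J) = (\<Sum>K\<in>tidx n n. if K = J then f K else 0)"
    unfolding tone_def using assms by (intro sum.cong) auto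
  then show ?thesis using assms by (simp add: sum.delta)
qed

lemma acts_as_tR:
  assumes "i \<in> {1..n}" "j \<in> {1..n}" "central w"
  shows "acts_as n (tR n n i j w) (row_R i j w)"
  unfolding acts_as_def
proof (intro allI impI ballI)
  fix f g :: "(nat \<Rightarrow> nat) \<Rightarrow> 'a" and J
  assume fg: "\<forall>J\<in>tidx n n. f J = g J" and J: "J \<in> tidx n n"
  have "row_act n (tR n n i j w) f J =
      (\<Sum>K\<in>tidx n n. f K * tone n n K J) - w * (\<Sum>K\<in>tidx n n. f K * tP n n i j K J)"
    unfolding row_act_def tR_def right_diff_distrib sum_subtractf sum_distrib_left
    by (simp only: central_left_commute[OF assms(3)])
  then show "row_act n (tR n n i j w) f J = row_R i j w g J"
    using fg J tidx_transpose[OF J assms(1,2)]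
    by (simp add: sum_mult_tone[OF J] sum_mult_tP[OF J assms(1,2)] row_R_def)
qed

lemma acts_as_Pi_op:
  assumes "k \<in> {1..n}"
  defines "w \<equiv> inv_2u_minus (of_nat k + of_nat n - 2)"
  shows "acts_as n (Pi_op n k) (row_Pi n k w)"
  unfolding acts_as_def
proof (intro allI impI ballI)
  fix f g :: "(nat \<Rightarrow> nat) \<Rightarrow> ('a, 'b) refl_alg fps" and J
  assume fg: "\<forall>J\<in>tidx n n. f J = g J" and J: "J \<in> tidx n n"
  have w: "central w"
    unfolding w_def inv_2u_minus_eq_refl_fps by (rule central_refl_fps)
  have "row_act n (Pi_op n k) f J = (\<Sum>K\<in>tidx n n. f K * tone n n K J) -
      w * (\<Sum>K\<in>tidx n n. \<Sum>i=k+1..n. f K * tP n n k i K J)"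
    unfolding row_act_def Pi_op_def right_diff_distrib sum_subtractf w_def[symmetric]
      central_left_commute[OF w]
    by (simp add: sum_distrib_left)
  also have "\<dots> = f J - w * (\<Sum>i=k+1..n. \<Sum>K\<in>tidx n n. f K * tP n n k i K J)"
    by (simp only: sum_mult_tone[OF J] sum.swap[of _ "tidx n n"])
  also have "\<dots> = f J - w * (\<Sum>i=k+1..n. f (J \<circ> Transposition.transpose k i))"
    using assms(1) by (simp add: sum_mult_tP[OF J])
  also have "\<dots> = row_Pi n k w g J"
    unfolding row_Pi_def using fg J assms(1)
    by (auto intro!: arg_cong[of _ _ "(*) w"] sum.cong tidx_transpose)
  finally show "row_act n (Pi_op n k) f J = row_Pi n k w g J" .
qed

text \<open>The relation \<open>rel\<close> reads
  \<open>(1 - P) B_1 R B'_2 = B'_2 R B_1 (1 - P)\<close>. Contracted with an alternating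
  \<open>f\<close>, the left side is twice the row vector in question, while the right side ends in
  \<open>1 - P\<close> and so alternates. It remains to cancel 2.\<close>

lemma alternates_on_reflection:
  fixes B B' :: "nat \<Rightarrow> nat \<Rightarrow> 'a::ring_1"
  assumes f: "alternates_on (tidx n n) i j f" and ij: "i \<in> {1..n}" "j \<in> {1..n}" "i \<noteq> j"
    and w: "central w" and double: "\<And>x :: 'a. x + x = 0 \<Longrightarrow> x = 0"
    and rel: "\<And>i1 i2 j1 j2. i1 \<in> {1..n} \<Longrightarrow> i2 \<in> {1..n} \<Longrightarrow> j1 \<in> {1..n} \<Longrightarrow> j2 \<in> {1..n} \<Longrightarrow>
      B i1 j1 * B' i2 j2 - B i2 j1 * B' i1 j2
        - (if i2 = j1 then w * (\<Sum>a=1..n. B i1 a * B' a j2) else 0)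
        + (if i1 = j1 then w * (\<Sum>a=1..n. B i2 a * B' a j2) else 0) =
      B' i2 j2 * B i1 j1 - B' i2 j1 * B i1 j2
        - (if i1 = j2 then w * (\<Sum>a=1..n. B' i2 a * B a j1) else 0)
        + (if i1 = j1 then w * (\<Sum>a=1..n. B' i2 a * B a j2) else 0)"
  shows "alternates_on (tidx n n) i j (row_temb n j B' (row_R i j w (row_temb n i B f)))"
  unfolding alternates_on_def
proof
  fix J assume J: "J \<in> tidx n n"
  define F where "F a b = f (J(i := a, j := b))" for a b
  have F: "F b a = - F a b" if "a \<in> {1..n}" "b \<in> {1..n}" for a b
  proof -
    have "J(i := b, j := a) = J(i := a, j := b) \<circ> Transposition.transpose i j"
      using ij(3) by (auto simp: fun_eq_iff Transposition.transpose_def)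
    moreover have "J(i := a, j := b) \<in> tidx n n"
      using J ij that by (intro tidx_upd)
    ultimately show ?thesis
      using f by (simp only: F_def alternates_on_def)
  qed
  \<comment> \<open>\<open>G\<close> is the transformed row vector as a function of its entries at
    \<open>i\<close> and \<open>j\<close>; \<open>H\<close> is the contraction of \<open>F\<close>
    with the right side of \<open>rel\<close>.\<close>
  define G where "G j1 j2 = (\<Sum>a=1..n. \<Sum>b=1..n. F a b * (B a j1 * B' b j2))
    - w * (\<Sum>a=1..n. F a j1 * (\<Sum>b=1..n. B a b * B' b j2))" for j1 j2
  define H where "H j1 j2 = (\<Sum>a=1..n. \<Sum>b=1..n. F a b * (B' b j2 * B a j1 - B' b j1 * B a j2
      - (if a = j2 then w * (\<Sum>c=1..n. B' b c * B c j1) else 0)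
      + (if a = j1 then w * (\<Sum>c=1..n. B' b c * B c j2) else 0)))" for j1 j2
  have GH: "G j1 j2 + G j1 j2 = H j1 j2" if j12: "j1 \<in> {1..n}" "j2 \<in> {1..n}" for j1 j2
  proof -
    let ?Q = "\<lambda>a. \<Sum>c=1..n. B a c * B' c j2"
    have "H j1 j2 = (\<Sum>a=1..n. \<Sum>b=1..n. F a b * (B a j1 * B' b j2 - B b j1 * B' a j2
        - (if b = j1 then w * ?Q a else 0) + (if a = j1 then w * ?Q b else 0)))"
      unfolding H_def using j12 by (intro sum.cong refl) (simp only: rel)
    also have "\<dots> = (\<Sum>a=1..n. \<Sum>b=1..n. F a b * (B a j1 * B' b j2))
        - (\<Sum>a=1..n. \<Sum>b=1..n. F a b * (B b j1 * B' a j2))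
        - (\<Sum>a=1..n. \<Sum>b=1..n. if b = j1 then w * (F a b * ?Q a) else 0)
        + (\<Sum>a=1..n. \<Sum>b=1..n. if a = j1 then w * (F a b * ?Q b) else 0)"
      by (simp only: distrib_left right_diff_distrib sum.distrib sum_subtractf
          if_distrib[of "(*) _"] mult_zero_right central_left_commute[OF w])
    also have "(\<Sum>a=1..n. \<Sum>b=1..n. F a b * (B b j1 * B' a j2)) =
        - (\<Sum>a=1..n. \<Sum>b=1..n. F a b * (B a j1 * B' b j2))"
    proof -
      have "(\<Sum>a=1..n. \<Sum>b=1..n. F a b * (B b j1 * B' a j2)) =
          (\<Sum>b=1..n. \<Sum>a=1..n. F a b * (B b j1 * B' a j2))"
        by (rule sum.swap)
      also have "\<dots> = (\<Sum>b=1..n. \<Sum>a=1..n. - (F b a * (B b j1 * B' a j2)))"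
      proof (intro sum.cong refl)
        fix a b assume "a \<in> {1..n}" "b \<in> {1..n}"
        then show "F b a * (B a j1 * B' b j2) = - (F a b * (B a j1 * B' b j2))"
          by (simp add: F[of a b])
      qed
      finally show ?thesis by (simp add: sum_negf)
    qed
    also have "(\<Sum>a=1..n. \<Sum>b=1..n. if b = j1 then w * (F a b * ?Q a) else 0) =
        w * (\<Sum>a=1..n. F a j1 * ?Q a)"
      using j12 by (simp add: sum.delta sum_distrib_left)
    also have "(\<Sum>a=1..n. \<Sum>b=1..n. if a = j1 then w * (F a b * ?Q b) else 0) =
        - (w * (\<Sum>a=1..n. F a j1 * ?Q a))"
    proof -
      have "(\<Sum>a=1..n. \<Sum>b=1..n. if a = j1 then w * (F a b * ?Q b) else 0) =
          (\<Sum>b=1..n. \<Sum>a=1..n. if a = j1 then w * (F a b * ?Q b) else 0)"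
        by (rule sum.swap)
      also have "\<dots> = (\<Sum>b=1..n. - (w * (F b j1 * ?Q b)))"
      proof (intro sum.cong refl)
        fix b assume b: "b \<in> {1..n}"
        have "(\<Sum>a=1..n. if a = j1 then w * (F a b * ?Q b) else 0) = w * (F j1 b * ?Q b)"
          using j12 by (simp add: sum.delta)
        then show "(\<Sum>a=1..n. if a = j1 then w * (F a b * ?Q b) else 0) = - (w * (F b j1 * ?Q b))"
          by (simp only: F[OF b j12(1)] mult_minus_left mult_minus_right)
      qed
      finally show ?thesis by (simp only: sum_negf sum_distrib_left)
    qed
    finally show ?thesis by (simp add: G_def)
  qed
  have HH: "H j2 j1 = - H j1 j2" for j1 j2
    unfolding H_def sum_negf[symmetric]
    by (intro sum.cong refl) (simp add: algebra_simps)
  have Jij: "J i \<in> {1..n}" "J j \<in> {1..n}"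
    using tidx_range[OF J] ij by auto
  have "G (J j) (J i) + G (J i) (J j) = 0"
  proof (rule double)
    have "G (J j) (J i) + G (J i) (J j) + (G (J j) (J i) + G (J i) (J j)) =
        (G (J j) (J i) + G (J j) (J i)) + (G (J i) (J j) + G (J i) (J j))"
      by (simp only: add_ac)
    also have "\<dots> = 0" by (simp only: GH[OF Jij] GH[OF Jij(2,1)] HH[of "J i" "J j"] add.right_inverse add.left_inverse)
    finally show "G (J j) (J i) + G (J i) (J j) + (G (J j) (J i) + G (J i) (J j)) = 0" .
  qed
  then have GG: "G (J j) (J i) = - G (J i) (J j)" by (simp add: eq_neg_iff_add_eq_0)
  \<comment> \<open>Both \<open>J\<close> and its transposed index qualify as \<open>K\<close>, so
    one formula serves both sides of the goal.\<close>
  have row: "row_temb n j B' (row_R i j w (row_temb n i B f)) K = G (K i) (K j)"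
    if K: "\<And>t. t \<notin> {i, j} \<Longrightarrow> K t = J t" for K
  proof -
    have e1: "K(j := b, i := a) = J(i := a, j := b)" for a b
      using K ij(3) by (auto simp: fun_eq_iff)
    have e2: "(K(j := b) \<circ> Transposition.transpose i j)(i := a) = J(i := a, j := K i)" for a b
      using K ij(3) by (auto simp: fun_eq_iff Transposition.transpose_def)
    have "row_temb n j B' (row_R i j w (row_temb n i B f)) K =
      (\<Sum>b=1..n. \<Sum>a=1..n. F a b * (B a (K i) * B' b (K j)))
      - (\<Sum>b=1..n. \<Sum>a=1..n. w * (F a (K i) * (B a b * B' b (K j))))"
      unfolding row_temb_def row_R_def e1 e2 F_def[symmetric] using ij(3)
      by (simp add: left_diff_distrib sum_subtractf sum_distrib_left sum_distrib_right mult.assoc)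
    also have "\<dots> = G (K i) (K j)"
      unfolding G_def sum_distrib_left by (intro arg_cong2[of _ _ _ _ "(-)"] sum.swap)
    finally show ?thesis .
  qed
  show "row_temb n j B' (row_R i j w (row_temb n i B f)) (J \<circ> Transposition.transpose i j) =
      - row_temb n j B' (row_R i j w (row_temb n i B f)) J"
    using row[of J] row[of "J \<circ> Transposition.transpose i j"] GG by simp
qed

section \<open>Alternating matrices\<close>

text \<open>The exchange is absorbed into the summation variable from the right, at the cost of a
  sign; for the column index it is absorbed from the left.\<close>

lemma antisymmetrizer_comp_transpose_left:
  assumes "i \<in> {1..n}" "j \<in> {1..n}" "i \<noteq> j"
  shows "antisymmetrizer n (I \<circ> Transposition.transpose i j) J = - (antisymmetrizer n I J :: 'a::ring_1)"
proof -
  let ?t = "Transposition.transpose i j"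
  have t: "?t permutes {1..n}" using assms by (intro permutes_swap_id)
  have "antisymmetrizer n (I \<circ> ?t) J =
      (\<Sum>\<sigma> | \<sigma> permutes {1..n}. of_int (sign (\<sigma> \<circ> ?t)) * (tperm n n (\<sigma> \<circ> ?t) (I \<circ> ?t) J :: 'a))"
    unfolding antisymmetrizer_def by (rule sum_permutations_compose_right[OF t])
  also have "\<dots> = (\<Sum>\<sigma> | \<sigma> permutes {1..n}. - (of_int (sign \<sigma>) * tperm n n \<sigma> I J))"
  proof (intro sum.cong refl)
    fix \<sigma> assume "\<sigma> \<in> {\<sigma>. \<sigma> permutes {1..n}}"
    then have "sign (\<sigma> \<circ> ?t) = - sign \<sigma>"
      using assms(3) by (subst sign_compose) (auto intro: permutation_permutes[THEN iffD2] simp: sign_swap_id permutation_swap_id)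
    moreover have "I \<circ> ?t = J \<circ> (\<sigma> \<circ> ?t) \<longleftrightarrow> I = J \<circ> \<sigma>"
      by (metis comp_assoc comp_transpose_transpose)
    ultimately show "of_int (sign (\<sigma> \<circ> ?t)) * (tperm n n (\<sigma> \<circ> ?t) (I \<circ> ?t) J :: 'a) =
        - (of_int (sign \<sigma>) * tperm n n \<sigma> I J)"
      by (simp add: tperm_def)
  qed
  finally show ?thesis by (simp add: antisymmetrizer_def sum_negf)
qed

lemma antisymmetrizer_comp_transpose_right:
  assumes "i \<in> {1..n}" "j \<in> {1..n}" "i \<noteq> j"
  shows "antisymmetrizer n I (J \<circ> Transposition.transpose i j) = - (antisymmetrizer n I J :: 'a::ring_1)"
proof -
  let ?t = "Transposition.transpose i j"
  have t: "?t permutes {1..n}" using assms by (intro permutes_swap_id)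
  have "antisymmetrizer n I (J \<circ> ?t) =
      (\<Sum>\<sigma> | \<sigma> permutes {1..n}. of_int (sign (?t \<circ> \<sigma>)) * (tperm n n (?t \<circ> \<sigma>) I (J \<circ> ?t) :: 'a))"
    unfolding antisymmetrizer_def by (rule setum_permutations_compose_left[OF t])
  also have "\<dots> = (\<Sum>\<sigma> | \<sigma> permutes {1..n}. - (of_int (sign \<sigma>) * tperm n n \<sigma> I J))"
  proof (intro sum.cong refl)
    fix \<sigma> assume "\<sigma> \<in> {\<sigma>. \<sigma> permutes {1..n}}"
    then have "sign (?t \<circ> \<sigma>) = - sign \<sigma>"
      using assms(3) by (subst sign_compose) (auto intro: permutation_permutes[THEN iffD2] simp: sign_swap_id permutation_swap_id)
    moreover have "J \<circ> ?t \<circ> (?t \<circ> \<sigma>) = J \<circ> \<sigma>"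
      by (metis comp_assoc comp_transpose_transpose)
    moreover have "J \<circ> ?t \<in> tidx n n \<longleftrightarrow> J \<in> tidx n n"
      by (metis assms(1,2) comp_transpose_transpose tidx_transpose)
    ultimately show "of_int (sign (?t \<circ> \<sigma>)) * (tperm n n (?t \<circ> \<sigma>) I (J \<circ> ?t) :: 'a) =
        - (of_int (sign \<sigma>) * tperm n n \<sigma> I J)"
      by (simp add: tperm_def)
  qed
  finally show ?thesis by (simp add: antisymmetrizer_def sum_negf)
qed

lemma antisymmetrizer_outside:
  assumes "I \<notin> tidx n n \<or> J \<notin> tidx n n"
  shows "antisymmetrizer n I J = (0 :: 'a::ring_1)"
  unfolding antisymmetrizer_def tperm_def using assms
  by (intro sum.neutral) (auto intro: tidx_comp)

text \<open>The multi-index \<open>(1, ..., n)\<close>, restricted so as to be extensional. The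
  antisymmetrizer has diagonal entry 1 there, so scalar factors can be read off.\<close>

definition id_index :: "nat \<Rightarrow> nat \<Rightarrow> nat" where
  "id_index n = (\<lambda>x\<in>{1..n}. x)"

lemma id_index_tidx: "id_index n \<in> tidx n n"
  by (auto simp: id_index_def tidx_def)

lemma antisymmetrizer_id: "antisymmetrizer n (id_index n) (id_index n) = (1 :: 'a::ring_1)"
proof -
  have id: "id_index n = id_index n \<circ> \<sigma> \<longleftrightarrow> \<sigma> = id" if \<sigma>: "\<sigma> permutes {1..n}" for \<sigma>
  proof
    assume *: "id_index n = id_index n \<circ> \<sigma>"
    have "\<sigma> x = x" for x
    proof (cases "x \<in> {1..n}")
      case True
      then show ?thesis
        using fun_cong[OF *, of x] permutes_in_image[OF \<sigma>, of x] by (simp add: id_index_def)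
    next
      case False
      then show ?thesis using \<sigma> by (rule permutes_not_in[rotated])
    qed
    then show "\<sigma> = id" by auto
  qed simp
  have "antisymmetrizer n (id_index n) (id_index n) =
      (\<Sum>\<sigma> | \<sigma> permutes {1..n}. if \<sigma> = id then 1 else (0 :: 'a))"
    unfolding antisymmetrizer_def tperm_def
    by (intro sum.cong) (auto simp: id id_index_tidx sign_id)
  then show ?thesis
    by (simp add: sum.delta permutes_id finite_permutations)
qed

text \<open>The transposition of \<open>i\<close> and \<open>Suc k\<close> is that of
  \<open>i\<close> and \<open>k\<close> conjugated by an adjacent one, which gives three sign
  changes.\<close>

lemma alternates_on_all:
  assumes adj: "\<And>i. 1 \<le> i \<Longrightarrow> i < n \<Longrightarrow> alternates_on (tidx n n) i (Suc i) f"
    and "1 \<le> i" "i < j" "j \<le> n"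
  shows "alternates_on (tidx n n) i j f"
proof -
  have "Suc i \<le> j" using \<open>i < j\<close> by simp
  then show ?thesis using \<open>j \<le> n\<close>
  proof (induction j rule: dec_induct)
    case base
    then show ?case using assms by auto
  next
    case (step k)
    have IH: "alternates_on (tidx n n) i k f" and adj': "alternates_on (tidx n n) k (Suc k) f"
      using step assms(2) by (auto intro: adj)
    show ?case
      unfolding alternates_on_def
    proof
      fix J assume J: "J \<in> tidx n n"
      let ?s = "Transposition.transpose k (Suc k)" and ?t = "Transposition.transpose i k"
      have k: "k \<in> {1..n}" "Suc k \<in> {1..n}" "i \<in> {1..n}"
        using step assms(2) by auto
      have "J \<circ> Transposition.transpose i (Suc k) = J \<circ> ?s \<circ> ?t \<circ> ?s"
        using step.hyps by (intro comp_transpose_conj) auto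
      then show "f (J \<circ> Transposition.transpose i (Suc k)) = - f J"
        using IH adj' J k by (simp add: alternates_on_def tidx_transpose)
    qed
  qed
qed

lemma alternating_perm:
  assumes f: "\<And>i j. i \<in> {1..n} \<Longrightarrow> j \<in> {1..n} \<Longrightarrow> i \<noteq> j \<Longrightarrow> alternates_on (tidx n n) i j f"
    and "\<sigma> permutes {1..n}" "J \<in> tidx n n"
  shows "f (J \<circ> \<sigma>) = of_int (sign \<sigma>) * f J"
  using finite_atLeastAtMost assms(2)
proof (induction rule: permutes_rev_induct)
  case (swap a b p)
  have sgn: "sign (p \<circ> Transposition.transpose a b) = - sign p"
    using swap.hyps by (subst sign_compose)
      (auto intro: permutation_permutes[THEN iffD2] simp: sign_swap_id permutation_swap_id)
  have "f (J \<circ> p \<circ> Transposition.transpose a b) = - f (J \<circ> p)"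
    using f[OF swap.hyps(1-3)] tidx_comp[OF swap.hyps(4) assms(3)] by (simp add: alternates_on_def)
  then show ?case
    by (simp only: sgn swap.IH comp_assoc of_int_minus mult_minus_left)
qed simp

text \<open>Exchanging two equal entries fixes \<open>J\<close>, so
  \<open>f J = - f J\<close>.\<close>

lemma alternating_not_inj:
  fixes f :: "(nat \<Rightarrow> nat) \<Rightarrow> 'a::ring_1"
  assumes f: "\<And>i j. i \<in> {1..n} \<Longrightarrow> j \<in> {1..n} \<Longrightarrow> i \<noteq> j \<Longrightarrow> alternates_on (tidx n n) i j f"
    and double: "\<And>x :: 'a. x + x = 0 \<Longrightarrow> x = 0" and J: "J \<in> tidx n n" "\<not> inj_on J {1..n}"
  shows "f J = 0"
proof -
  obtain i j where ij: "i \<in> {1..n}" "j \<in> {1..n}" "i \<noteq> j" "J i = J j"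
    using J(2) by (auto simp: inj_on_def)
  have "J \<circ> Transposition.transpose i j = J"
    using ij(4) by (auto simp: fun_eq_iff Transposition.transpose_def)
  then have "f J = - f J"
    using f[OF ij(1-3)] J(1) by (auto simp: alternates_on_def)
  then have "f J + f J = 0" by (simp only: eq_neg_iff_add_eq_0)
  then show ?thesis by (rule double)
qed

lemma inj_index_eq_perm:
  assumes J: "J \<in> tidx n n" "inj_on J {1..n}"
  obtains \<sigma> where "\<sigma> permutes {1..n}" "J = id_index n \<circ> \<sigma>"
proof
  let ?\<sigma> = "\<lambda>x. if x \<in> {1..n} then J x else x"
  have JJ: "J ` {1..n} \<subseteq> {1..n}" using tidx_range[OF J(1)] by auto
  have "bij_betw J {1..n} {1..n}"
    using J(2) JJ endo_inj_surj[of "{1..n}" J] by (auto simp: bij_betw_def)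
  then have "bij_betw ?\<sigma> {1..n} {1..n}"
    by (subst bij_betw_cong[of _ _ J]) auto
  then show "?\<sigma> permutes {1..n}" by (rule bij_imp_permutes) auto
  show "J = id_index n \<circ> ?\<sigma>"
  proof
    fix x
    show "J x = (id_index n \<circ> ?\<sigma>) x"
      using J(1) tidx_range[OF J(1), of x] by (cases "x \<in> {1..n}") (auto simp: id_index_def tidx_def PiE_iff extensional_def)
  qed
qed

text \<open>Entries with a repeated index vanish in both matrices. All others are carried to the
  entry at \<open>id_index n\<close> by two permutations, with the same signs for \<open>M\<close>
  and \<open>N\<close>.\<close>

lemma alternating_tmat_eq:
  fixes M N :: "'a::ring_1 tmat"
  assumes double: "\<And>x :: 'a. x + x = 0 \<Longrightarrow> x = 0"
    and out: "\<And>I J. I \<notin> tidx n n \<or> J \<notin> tidx n n \<Longrightarrow> M I J = 0 \<and> N I J = 0"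
    and rows: "\<And>i j I. i \<in> {1..n} \<Longrightarrow> j \<in> {1..n} \<Longrightarrow> i \<noteq> j \<Longrightarrow>
      alternates_on (tidx n n) i j (M I) \<and> alternates_on (tidx n n) i j (N I)"
    and cols: "\<And>i j J. i \<in> {1..n} \<Longrightarrow> j \<in> {1..n} \<Longrightarrow> i \<noteq> j \<Longrightarrow>
      alternates_on (tidx n n) i j (\<lambda>I. M I J) \<and> alternates_on (tidx n n) i j (\<lambda>I. N I J)"
    and N1: "N (id_index n) (id_index n) = 1"
  shows "M = tscale (M (id_index n) (id_index n)) N"
proof (intro ext)
  fix I J
  let ?e = "id_index n"
  show "M I J = tscale (M ?e ?e) N I J"
  proof (cases "I \<in> tidx n n \<and> J \<in> tidx n n")
    case False
    then have "M I J = 0" "N I J = 0" using out[of I J] by auto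
    then show ?thesis by (simp add: tscale_def)
  next
    case IJ: True
    consider "\<not> inj_on I {1..n}" | "\<not> inj_on J {1..n}" | "inj_on I {1..n}" "inj_on J {1..n}" by blast
    then show ?thesis
    proof cases
      case 1
      have "M I J = 0" "N I J = 0"
        using alternating_not_inj[of n "\<lambda>I. M I J" I] alternating_not_inj[of n "\<lambda>I. N I J" I]
          cols double IJ 1 by blast+
      then show ?thesis by (simp add: tscale_def)
    next
      case 2
      have "M I J = 0" "N I J = 0"
        using alternating_not_inj[of n "M I" J] alternating_not_inj[of n "N I" J]
          rows double IJ 2 by blast+
      then show ?thesis by (simp add: tscale_def)
    next
      case 3
      obtain \<rho> \<tau> where \<rho>: "\<rho> permutes {1..n}" "I = ?e \<circ> \<rho>" and \<tau>: "\<tau> permutes {1..n}" "J = ?e \<circ> \<tau>"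
        using inj_index_eq_perm 3 IJ by metis
      have sgn: "L I J = of_int (sign \<rho>) * (of_int (sign \<tau>) * L ?e ?e)"
        if "\<And>i j I. i \<in> {1..n} \<Longrightarrow> j \<in> {1..n} \<Longrightarrow> i \<noteq> j \<Longrightarrow> alternates_on (tidx n n) i j (L I)"
          "\<And>i j J. i \<in> {1..n} \<Longrightarrow> j \<in> {1..n} \<Longrightarrow> i \<noteq> j \<Longrightarrow> alternates_on (tidx n n) i j (\<lambda>I. L I J)"
        for L :: "'a tmat"
        using alternating_perm[of n "\<lambda>I. L I J", OF that(2) \<rho>(1) id_index_tidx]
          alternating_perm[of n "L ?e", OF that(1) \<tau>(1) id_index_tidx] \<rho>(2) \<tau>(2) by simp
      have M: "M I J = of_int (sign \<rho>) * of_int (sign \<tau>) * M ?e ?e"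
        and N: "N I J = of_int (sign \<rho>) * of_int (sign \<tau>)"
        using sgn[of M] sgn[of N] rows cols N1 by (simp_all add: mult.assoc)
      show ?thesis
        unfolding tscale_def M N by (intro centralD central_mult central_of_int)
    qed
  qed
qed

section \<open>The brackets of the Sklyanin determinant\<close>

text \<open>The relation between the scalars of consecutive \<open>R\<close>-factors, behind both
  the telescoping and the Yang--Baxter step.\<close>

lemma inv_2u_minus_diff:
  "inv_2u_minus (c + 1) - inv_2u_minus c = inv_2u_minus c * (inv_2u_minus (c + 1) :: ('m::len0, 'l::len0) refl_alg fps)"
proof -
  let ?X = "fps_X :: complex fps"
  define w where "w c = fps_const (1/2) * (inv_u_minus (c/2) :: complex fps)" for c
  \<comment> \<open>\<open>a c\<close> is the denominator \<open>2u - c\<close> divided by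
    \<open>u\<close>.\<close>
  define a where "a c = fps_const 2 * (1 - fps_const (c/2) * ?X)" for c
  have aw: "a c * w c = ?X" for c
  proof -
    have "a c * w c = (fps_const 2 * fps_const (1/2)) * ((1 - fps_const (c/2) * ?X) * inv_u_minus (c/2))"
      unfolding a_def w_def by (simp only: mult_ac)
    then show ?thesis by (simp add: inv_u_minus_eq)
  qed
  have aa: "a c - a (c + 1) = ?X"
    by (rule fps_ext) (simp add: a_def fps_X_def field_simps)
  have "a c * a (c + 1) * (w (c + 1) - w c) = a c * (a (c + 1) * w (c + 1)) - a (c + 1) * (a c * w c)"
    by (simp add: algebra_simps)
  also have "\<dots> = (a c - a (c + 1)) * ?X"
    by (simp only: aw left_diff_distrib)
  also have "\<dots> = (a c * w c) * (a (c + 1) * w (c + 1))"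
    by (simp only: aa aw)
  also have "\<dots> = a c * a (c + 1) * (w c * w (c + 1))"
    by (simp only: mult_ac)
  finally have "a c * a (c + 1) * (w (c + 1) - w c) = a c * a (c + 1) * (w c * w (c + 1))" .
  moreover have "fps_nth (a c * a (c + 1)) 0 \<noteq> 0"
    by (simp add: a_def)
  ultimately have "w (c + 1) - w c = w c * w (c + 1)"
    using mult_left_cancel[of "a c * a (c + 1)"] by fastforce
  then show ?thesis
    by (simp only: inv_2u_minus_eq_refl_fps w_def flip: refl_fps_diff refl_fps_mult)
qed

text \<open>The scalar of \<open>R_op n i j\<close>; for \<open>j = n\<close> it is also the scalar
  of \<open>Pi_op n i\<close>.\<close>

definition R_inv :: "nat \<Rightarrow> nat \<Rightarrow> ('m::len0, 'l::len0) refl_alg fps" where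
  "R_inv i j = inv_2u_minus (of_nat i + of_nat j - 2)"

lemma central_R_inv: "central (R_inv i j)"
  unfolding R_inv_def inv_2u_minus_eq_refl_fps by (rule central_refl_fps)

lemma R_inv_commute: "R_inv i j = R_inv j i"
  by (simp add: R_inv_def add.commute)

lemma R_inv_diff: "R_inv i (Suc j) - R_inv i j = R_inv i j * R_inv i (Suc j)"
proof -
  have "of_nat i + of_nat (Suc j) - 2 = (of_nat i + of_nat j - 2 :: complex) + 1" by simp
  then show ?thesis
    unfolding R_inv_def by (simp only: inv_2u_minus_diff)
qed

text \<open>The block of \<open>sbracket n\<close> that begins with the \<open>k\<close>-th matrix.
  \<open>fold\<close> applies the leftmost factor first, as suits an action from the right.\<close>

definition row_step :: "nat \<Rightarrow> nat \<Rightarrow> ((nat \<Rightarrow> nat) \<Rightarrow> ('m::len0, 'l::len0) refl_alg fps) \<Rightarrow>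
    (nat \<Rightarrow> nat) \<Rightarrow> ('m, 'l) refl_alg fps" where
  "row_step n k f = fold (\<lambda>j. row_R k j (R_inv k j)) [k+1..<n+1] (row_temb n k (B_shift (k - 1)) f)"

definition row_step2 :: "nat \<Rightarrow> nat \<Rightarrow> ((nat \<Rightarrow> nat) \<Rightarrow> ('m::len0, 'l::len0) refl_alg fps) \<Rightarrow>
    (nat \<Rightarrow> nat) \<Rightarrow> ('m, 'l) refl_alg fps" where
  "row_step2 n k f = (if k < n then row_Pi n k (R_inv k n) else (\<lambda>f. f)) (row_temb n k (B_shift (k - 1)) f)"

section \<open>The brackets as compositions of blocks on row vectors\<close>

lemma list_all2_concat_map:
  "(\<And>k. k \<in> set ks \<Longrightarrow> list_all2 P (f k) (g k)) \<Longrightarrow> list_all2 P (concat (map f ks)) (concat (map g ks))"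
  by (induction ks) (auto intro: list_all2_appendI)

lemma fold_concat_map: "fold h (concat (map g ks)) z = fold (\<lambda>k. fold h (g k)) ks z"
  by (induction ks arbitrary: z) simp_all

lemma acts_as_B_op: "k \<in> {1..n} \<Longrightarrow> acts_as n (B_op n k c) (row_temb n k (B_shift c))"
  unfolding B_op_def B_shift_def[abs_def] by (rule acts_as_temb)

lemma acts_as_R_op: "i \<in> {1..n} \<Longrightarrow> j \<in> {1..n} \<Longrightarrow> acts_as n (R_op n i j) (row_R i j (R_inv i j))"
  unfolding R_op_def R_inv_def[symmetric] by (intro acts_as_tR central_R_inv)

lemma tmult_sbracket:
  fixes Z :: "('m::len0, 'l::len0) refl_alg fps tmat"
  assumes "J \<in> tidx n n"
  shows "tmult n n Z (sbracket n) I J = fold (row_step n) [1..<n+1] (Z I) J"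
proof -
  define ps :: "nat \<Rightarrow> (((nat \<Rightarrow> nat) \<Rightarrow> ('m, 'l) refl_alg fps) \<Rightarrow> (nat \<Rightarrow> nat) \<Rightarrow> ('m, 'l) refl_alg fps) list"
    where "ps k = row_temb n k (B_shift (k - 1)) # map (\<lambda>j. row_R k j (R_inv k j)) [k+1..<n+1]" for k
  have "tmult n n Z (sbracket n) I J = fold (\<lambda>p. p) (concat (map ps [1..<n+1])) (Z I) J"
    unfolding sbracket_def
  proof (rule tmult_tprod_acts_as[OF list_all2_concat_map assms])
    fix k assume "k \<in> set [1..<n+1]"
    then show "list_all2 (acts_as n) (B_op n k (k - 1) # map (\<lambda>j. R_op n k j) [k+1..<n+1]) (ps k)"
      unfolding ps_def
      by (auto simp: list.rel_map intro!: list.rel_refl_strong acts_as_B_op acts_as_R_op)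
  qed
  also have "\<dots> = fold (row_step n) [1..<n+1] (Z I) J"
  proof -
    have "fold (\<lambda>p. p) (ps k) = row_step n k" for k
      by (rule ext) (simp add: ps_def row_step_def fold_map o_def)
    then show ?thesis by (simp only: fold_concat_map)
  qed
  finally show ?thesis .
qed

lemma tmult_sbracket2:
  fixes Z :: "('m::len0, 'l::len0) refl_alg fps tmat"
  assumes "J \<in> tidx n n"
  shows "tmult n n Z (sbracket2 n) I J = fold (row_step2 n) [1..<n+1] (Z I) J"
proof -
  define ps :: "nat \<Rightarrow> (((nat \<Rightarrow> nat) \<Rightarrow> ('m, 'l) refl_alg fps) \<Rightarrow> (nat \<Rightarrow> nat) \<Rightarrow> ('m, 'l) refl_alg fps) list"
    where "ps k = row_temb n k (B_shift (k - 1)) # (if k < n then [row_Pi n k (R_inv k n)] else [])" for k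
  have "tmult n n Z (sbracket2 n) I J = fold (\<lambda>p. p) (concat (map ps [1..<n+1])) (Z I) J"
    unfolding sbracket2_def
  proof (rule tmult_tprod_acts_as[OF list_all2_concat_map assms])
    fix k assume "k \<in> set [1..<n+1]"
    then show "list_all2 (acts_as n) (B_op n k (k - 1) # (if k < n then [Pi_op n k] else [])) (ps k)"
      unfolding ps_def R_inv_def by (auto intro!: acts_as_B_op acts_as_Pi_op)
  qed
  also have "\<dots> = fold (row_step2 n) [1..<n+1] (Z I) J"
  proof -
    have "fold (\<lambda>p. p) (ps k) = row_step2 n k" for k
      by (rule ext) (simp add: ps_def row_step2_def)
    then show ?thesis by (simp only: fold_concat_map)
  qed
  finally show ?thesis .
qed

text \<open>Block \<open>k\<close> telescopes because its input alternates beyond \<open>k\<close>;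
  its output still does so, which is all that the later blocks ask for.\<close>

lemma fold_row_step_eq:
  assumes "1 \<le> k" "k \<le> n + 1"
    and "\<And>i j. k \<le> i \<Longrightarrow> i < j \<Longrightarrow> j \<le> n \<Longrightarrow> alternates_on UNIV i j f"
  shows "fold (row_step n) [k..<n+1] f = fold (row_step2 n) [k..<n+1] f"
  using assms(2,1,3)
proof (induction k arbitrary: f rule: inc_induct)
  case (step k)
  let ?f = "row_temb n k (B_shift (k - 1)) f"
  have f: "alternates_on UNIV i j ?f" if "k < i" "i < j" "j \<le> n" for i j
    using that step.prems(2)[of i j] by (intro alternates_on_row_temb) auto
  have k: "k \<le> n" using step.hyps by simp
  have "row_step n k f = row_Pi n k (R_inv k n) ?f"
    unfolding row_step_def
    by (rule fold_row_R_eq_row_Pi[where W = "R_inv k", OF f R_inv_diff central_R_inv k order_refl])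
  \<comment> \<open>For \<open>k = n\<close> the sum in \<open>row_Pi\<close> is empty, which
    matches the missing last factor.\<close>
  moreover have "row_step2 n k f = row_Pi n k (R_inv k n) ?f"
    using k by (auto simp: row_step2_def row_Pi_def)
  moreover have "alternates_on UNIV i j (row_Pi n k (R_inv k n) ?f)" if "Suc k \<le> i" "i < j" "j \<le> n" for i j
    using that by (intro alternates_on_row_Pi f) auto
  ultimately show ?case
    using step.IH[of "row_step n k f"] step.prems(1) k by (simp add: upt_conv_Cons)
qed simp

text \<open>For \<open>k < i\<close> the factors at \<open>i\<close> and \<open>Suc i\<close> are
  neighbours and pass by the Yang--Baxter equation; every other factor, and every factor when
  \<open>k > Suc i\<close>, avoids both positions.\<close>

lemma row_step_alternates_other:
  fixes f :: "(nat \<Rightarrow> nat) \<Rightarrow> ('m::len0, 'l::len0) refl_alg fps"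
  assumes f: "alternates_on (tidx n n) i (Suc i) f" and i: "1 \<le> i" "i < n"
    and k: "1 \<le> k" "k \<le> n" "k \<noteq> i" "k \<noteq> Suc i"
  shows "alternates_on (tidx n n) i (Suc i) (row_step n k f)"
proof -
  let ?A = "alternates_on (tidx n n) i (Suc i)"
  have B: "?A (row_temb n k (B_shift (k - 1)) f)"
    using k by (intro alternates_on_row_temb f tidx_upd) auto
  have R: "?A (fold (\<lambda>j. row_R k j (R_inv k j)) js g)"
    if "?A g" "set js \<subseteq> {1..n} - {i, Suc i}"
    for js and g :: "(nat \<Rightarrow> nat) \<Rightarrow> ('m, 'l) refl_alg fps"
    using that
  proof (induction js arbitrary: g)
    case (Cons j js)
    have "?A (row_R k j (R_inv k j) g)"
      using Cons.prems k by (intro alternates_on_row_R tidx_transpose) auto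
    then show ?case using Cons by simp
  qed simp
  show ?thesis
  proof (cases "k < i")
    case True
    have js: "[k+1..<n+1] = [k+1..<i] @ i # Suc i # [i+2..<n+1]"
      using True i upt_add_eq_append[of "k+1" i "n+1-i"] by (simp add: upt_conv_Cons)
    define g where "g = fold (\<lambda>j. row_R k j (R_inv k j)) [k+1..<i] (row_temb n k (B_shift (k - 1)) f)"
    have "?A g"
      unfolding g_def using i by (intro R B) auto
    then have "?A (row_R k (Suc i) (R_inv k (Suc i)) (row_R k i (R_inv k i) g))"
      using True i k by (intro alternates_on_row_R_pair R_inv_diff central_R_inv tidx_transpose) auto
    then have "?A (fold (\<lambda>j. row_R k j (R_inv k j)) [i+2..<n+1]
        (row_R k (Suc i) (R_inv k (Suc i)) (row_R k i (R_inv k i) g)))"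
      by (rule R) auto
    then show ?thesis
      by (simp only: row_step_def js g_def fold_append fold.simps o_apply)
  next
    case False
    then show ?thesis
      unfolding row_step_def using k by (intro R B) auto
  qed
qed

text \<open>Only the two blocks together preserve alternation. The second matrix is moved left past
  the \<open>R\<close>-factors of block \<open>i\<close> beyond the first; the reflection equation
  handles the two matrices with the \<open>R\<close> between them, and the remaining factors are
  sorted into Yang--Baxter pairs.\<close>

lemma row_step_alternates_pair:
  fixes f :: "(nat \<Rightarrow> nat) \<Rightarrow> ('m::len0, 'l::len0) refl_alg fps"
  assumes n: "n = LENGTH('m) + LENGTH('l)"
    and f: "alternates_on (tidx n n) i (Suc i) f" and i: "1 \<le> i" "i < n"
  shows "alternates_on (tidx n n) i (Suc i) (row_step n (Suc i) (row_step n i f))"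
proof -
  let ?A = "alternates_on (tidx n n) i (Suc i)"
  let ?R = "\<lambda>k j. row_R k j (R_inv k j)" and ?js = "[i+2..<n+1]"
  define g where "g = row_temb n (Suc i) (B_shift i) (?R i (Suc i) (row_temb n i (B_shift (i - 1)) f))"
  have g: "?A g"
    unfolding g_def
  proof (rule alternates_on_reflection[OF f _ _ _ central_R_inv refl_fps_double_eq_0])
    \<comment> \<open>The argument \<open>2u - 2i + 1\<close> is the sum of the shifted arguments
      \<open>u - (i - 1)\<close> and \<open>u - i\<close>, as the reflection equation
      demands.\<close>
    have w: "R_inv i (Suc i) = inv_2u_minus (of_nat (2 * (i - 1) + 1))"
      using i(1) by (simp add: R_inv_def of_nat_diff algebra_simps)
    have c: "Suc (i - 1) = i" using i(1) by simp
    fix i1 i2 j1 j2 assume "i1 \<in> {1..n}" "i2 \<in> {1..n}" "j1 \<in> {1..n}" "j2 \<in> {1..n}"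
    from reflection_shift[OF n this, of "i - 1", folded w, unfolded c]
    show "(B_shift (i - 1) i1 j1 :: ('m, 'l) refl_alg fps) * B_shift i i2 j2 - B_shift (i - 1) i2 j1 * B_shift i i1 j2
        - (if i2 = j1 then R_inv i (Suc i) * (\<Sum>a=1..n. B_shift (i - 1) i1 a * B_shift i a j2) else 0)
        + (if i1 = j1 then R_inv i (Suc i) * (\<Sum>a=1..n. B_shift (i - 1) i2 a * B_shift i a j2) else 0) =
      B_shift i i2 j2 * B_shift (i - 1) i1 j1 - B_shift i i2 j1 * B_shift (i - 1) i1 j2
        - (if i1 = j2 then R_inv i (Suc i) * (\<Sum>a=1..n. B_shift i i2 a * B_shift (i - 1) a j1) else 0)
        + (if i1 = j1 then R_inv i (Suc i) * (\<Sum>a=1..n. B_shift i i2 a * B_shift (i - 1) a j2) else 0)" .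
  qed (use i in auto)
  have comm: "row_temb n (Suc i) (B_shift i) (fold (?R i) ?js h) = fold (?R i) ?js (row_temb n (Suc i) (B_shift i) h)"
    for h :: "(nat \<Rightarrow> nat) \<Rightarrow> ('m, 'l) refl_alg fps"
    by (rule fold_commute_apply[where h = "row_temb n (Suc i) (B_shift i)"])
      (auto simp: fun_eq_iff row_R_commute_temb[symmetric] central_R_inv)
  have js: "[i+1..<n+1] = Suc i # ?js"
    using i by (simp add: upt_conv_Cons flip: Suc_eq_plus1)
  have e: "Suc i + 1 = i + 2" "Suc i - 1 = i" by simp_all
  have eq1: "row_step n (Suc i) (row_step n i f) = fold (?R (Suc i)) ?js (fold (?R i) ?js g)"
    by (simp only: row_step_def js e fold.simps o_apply comm g_def)
  have eq2: "fold (?R (Suc i)) ?js (fold (?R i) ?js g) = fold (\<lambda>j. ?R (Suc i) j \<circ> ?R i j) ?js g"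
  proof (rule fold_fold_interleave)
    fix j k :: nat and h :: "(nat \<Rightarrow> nat) \<Rightarrow> ('m, 'l) refl_alg fps"
    assume "j \<in> set ?js" "k \<in> set ?js" "j \<noteq> k"
    then show "?R (Suc i) j (?R i k h) = ?R i k (?R (Suc i) j h)"
      by (intro row_R_commute central_R_inv) auto
  qed simp
  show ?thesis
    unfolding eq1 eq2
  proof -
    have pair: "?A ((?R (Suc i) j \<circ> ?R i j) h)" if "?A h" "j \<in> {1..n}" "j \<noteq> i" "j \<noteq> Suc i"
      for j and h :: "(nat \<Rightarrow> nat) \<Rightarrow> ('m, 'l) refl_alg fps"
    proof -
      \<comment> \<open>Here the common index \<open>j\<close> is the second one, so the symmetry of
        \<open>R\<close> is used to bring it to the front.\<close>
      have "?A (row_R j (Suc i) (R_inv j (Suc i)) (row_R j i (R_inv j i) h))"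
        using that i by (intro alternates_on_row_R_pair R_inv_diff central_R_inv tidx_transpose) auto
      then show ?thesis
        by (simp only: o_apply row_R_sym[of j "Suc i"] row_R_sym[of j i] R_inv_commute[of j "Suc i"] R_inv_commute[of j i])
    qed
    have pairs: "?A (fold (\<lambda>j. ?R (Suc i) j \<circ> ?R i j) js h)" if "?A h" "set js \<subseteq> {1..n} - {i, Suc i}"
      for js and h :: "(nat \<Rightarrow> nat) \<Rightarrow> ('m, 'l) refl_alg fps"
      using that
    proof (induction js arbitrary: h)
      case (Cons j js)
      then have "?A ((?R (Suc i) j \<circ> ?R i j) h)" by (intro pair) auto
      with Cons show ?case by simp
    qed simp
    show "?A (fold (\<lambda>j. ?R (Suc i) j \<circ> ?R i j) ?js g)"
      by (rule pairs[OF g]) auto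
  qed
qed

lemma fold_row_step_alternates:
  fixes f :: "(nat \<Rightarrow> nat) \<Rightarrow> ('m::len0, 'l::len0) refl_alg fps"
  assumes n: "n = LENGTH('m) + LENGTH('l)"
    and f: "alternates_on (tidx n n) i (Suc i) f" and i: "1 \<le> i" "i < n"
  shows "alternates_on (tidx n n) i (Suc i) (fold (row_step n) [1..<n+1] f)"
proof -
  let ?A = "alternates_on (tidx n n) i (Suc i)"
  have other: "?A (fold (row_step n) ks g)" if "?A g" "set ks \<subseteq> {1..n} - {i, Suc i}"
    for ks and g :: "(nat \<Rightarrow> nat) \<Rightarrow> ('m, 'l) refl_alg fps"
    using that
  proof (induction ks arbitrary: g)
    case (Cons k ks)
    then have "?A (row_step n k g)"
      using i by (intro row_step_alternates_other) auto
    with Cons show ?case by simp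
  qed simp
  have ks: "[1..<n+1] = [1..<i] @ i # Suc i # [i+2..<n+1]"
    using i upt_add_eq_append[of 1 i "n+1-i"] by (simp add: upt_conv_Cons)
  have "?A (fold (row_step n) [1..<i] f)"
    using f i by (intro other) auto
  then have "?A (row_step n (Suc i) (row_step n i (fold (row_step n) [1..<i] f)))"
    by (rule row_step_alternates_pair[OF n _ i])
  then have "?A (fold (row_step n) [i+2..<n+1] (row_step n (Suc i) (row_step n i (fold (row_step n) [1..<i] f))))"
    by (rule other) auto
  then show ?thesis
    by (simp only: ks fold_append fold.simps o_apply)
qed

theorem proposition2:
  fixes n :: nat
  assumes "n = LENGTH('m::len0) + LENGTH('l::len0)"
  shows "tmult n n (antisymmetrizer n) (sbracket2 n) =
    tscale (sdet :: ('m, 'l) refl_alg fps) (antisymmetrizer n)"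
proof -
  let ?A = "antisymmetrizer n :: ('m, 'l) refl_alg fps tmat"
  define M where "M = tmult n n ?A (sbracket n)"
  \<comment> \<open>The candidate for \<open>sdet\<close>, read off where the antisymmetrizer has
    entry 1.\<close>
  define s where "s = M (id_index n) (id_index n)"
  have A: "alternates_on UNIV i j (?A I)" if "i \<in> {1..n}" "j \<in> {1..n}" "i \<noteq> j" for i j I
    by (simp add: alternates_on_def antisymmetrizer_comp_transpose_right[OF that])
  have MJ: "M I J = fold (row_step n) [1..<n+1] (?A I) J" if "J \<in> tidx n n" for I J
    unfolding M_def by (rule tmult_sbracket[OF that])
  \<comment> \<open>Adjacent positions are the ones the bracket is shown to respect;
    \<open>alternates_on_all\<close> then reaches all pairs.\<close>
  have M_adj: "alternates_on (tidx n n) i (Suc i) (M I)" if "1 \<le> i" "i < n" for i I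
  proof -
    have "alternates_on (tidx n n) i (Suc i) (?A I)"
      using A[of i "Suc i" I] that by (simp add: alternates_on_def)
    from fold_row_step_alternates[OF assms this that] show ?thesis
      using that by (simp add: alternates_on_def MJ tidx_transpose)
  qed
  have M_rows: "alternates_on (tidx n n) i j (M I)" if "i \<in> {1..n}" "j \<in> {1..n}" "i \<noteq> j" for i j I
  proof (cases "i < j")
    case True
    then show ?thesis using that by (intro alternates_on_all[OF M_adj]) auto
  next
    case False
    then have "alternates_on (tidx n n) j i (M I)" using that by (intro alternates_on_all[OF M_adj]) auto
    then show ?thesis by (simp add: alternates_on_def transpose_commute)
  qed
  \<comment> \<open>Alternation in the first multi-index comes from the left factor alone.\<close>
  have M_cols: "alternates_on (tidx n n) i j (\<lambda>I. M I J)" if "i \<in> {1..n}" "j \<in> {1..n}" "i \<noteq> j" for i j J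
    unfolding alternates_on_def M_def tmult_def
    by (simp add: antisymmetrizer_comp_transpose_left[OF that] sum_negf)
  have out: "M I J = 0 \<and> ?A I J = 0" if "I \<notin> tidx n n \<or> J \<notin> tidx n n" for I J
  proof -
    have "M I J = 0"
    proof (cases "J \<in> tidx n n")
      case True
      with that have "?A I K = 0" for K by (simp add: antisymmetrizer_outside)
      then show ?thesis by (simp add: M_def tmult_def)
    next
      case False
      then show ?thesis unfolding M_def sbracket_def by (rule tmult_tprod_outside)
    qed
    then show ?thesis using antisymmetrizer_outside[OF that] by blast
  qed
  have Ms: "M = tscale s ?A"
    unfolding s_def
  proof (rule alternating_tmat_eq[OF refl_fps_double_eq_0 out])
    fix i j :: nat and I
    assume ij: "i \<in> {1..n}" "j \<in> {1..n}" "i \<noteq> j"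
    show "alternates_on (tidx n n) i j (M I) \<and> alternates_on (tidx n n) i j (?A I)"
      using M_rows[OF ij] A[OF ij, of I] by (simp add: alternates_on_def)
    show "alternates_on (tidx n n) i j (\<lambda>J. M J I) \<and> alternates_on (tidx n n) i j (\<lambda>J. ?A J I)"
      using M_cols[OF ij] by (simp add: alternates_on_def antisymmetrizer_comp_transpose_left[OF ij])
  qed (auto simp: antisymmetrizer_id)
  \<comment> \<open>Existence for the \<open>THE\<close> in \<open>sdet\<close> is
    \<open>Ms\<close>; comparing the entries at \<open>id_index n\<close> gives uniqueness.\<close>
  have "sdet = s"
    unfolding sdet_def Let_def assms[symmetric] M_def[symmetric]
  proof (rule the_equality)
    show "M = tscale s ?A" by (rule Ms)
  next
    fix s' assume "M = tscale s' ?A"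
    then have "M (id_index n) (id_index n) = s' * ?A (id_index n) (id_index n)"
      by (simp add: tscale_def)
    then show "s' = s" by (simp add: s_def antisymmetrizer_id)
  qed
  moreover have "tmult n n ?A (sbracket2 n) = M"
  proof (intro ext)
    fix I J
    show "tmult n n ?A (sbracket2 n) I J = M I J"
    proof (cases "J \<in> tidx n n")
      case True
      have "fold (row_step n) [1..<n+1] (?A I) = fold (row_step2 n) [1..<n+1] (?A I)"
        by (rule fold_row_step_eq) (auto intro: A)
      then show ?thesis
        by (simp only: MJ[OF True] tmult_sbracket2[OF True])
    next
      case False
      then show ?thesis
        using out[of I J] by (simp add: sbracket2_def tmult_tprod_outside)
    qed
  qed
  ultimately show ?thesis using Ms by simp
qed

end
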